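(* Let $u_0^*$ be a compactly supported signed Radon measure on $\mathbb{R}^d$ with finite total variation, and let $u(x,t)=(G(\cdot,t)*u_0^* )(x)$ for $t>0$ be the corresponding solution of the heat equation $\partial_t u-\Delta u=0$, $u(\cdot,0)=u_0^*$. Let $R>0$ be such that $\operatorname{supp}(u_0^* )\subseteq[-R,R]^d=:\Omega$. Fix $k\in\mathbb{Z}_+$ with $k\ge 1$ and $T>0$, let $\mathbf{y}=(y_\alpha)_{\|\alpha\|_1\le k}$ be any real vector, and define the observation error $\epsilon=(\epsilon_\alpha)_{\|\alpha\|_1\le k}$ by $\epsilon_\alpha=y_\alpha-\int_{\mathbb{R}^d}x^\alpha u(x,T)\,dx$. Let $u_0^k$ be any solution of $(P_{\Omega,k})$ with data $\mathbf{y}$. Then $$\|u_0^k-u_0^*\|_{\mathrm{Kant}}\le \frac{C_d\,R\,\|u_0^*\|_{\mathrm{TV}}}{k}+C_{d,R}(k)\,\max\{T^{\lfloor k/2\rfloor},1\}\,\|\epsilon\|_\infty,$$ where $C_d>0$ is a constant depending only on $d$ and $$C_{d,R}(k)=\Big(\sqrt{\tfrac{k}{\pi}}+\tfrac{C_d R}{\sqrt{\pi k}}\Big)\exp\Big(k\big(1+2d/R+\ln\sqrt{k}\big)\Big).$$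
   Context: Heat kernel: $G(x,t)=(4\pi t)^{-d/2}\exp(-\|x\|^2/(4t))$ for $(x,t)\in\mathbb{R}^d\times(0,\infty)$. Multi-index notation: $x^\alpha=x_1^{\alpha_1}\cdots x_d^{\alpha_d}$, $\|\alpha\|_1=\sum_i\alpha_i$; $\|\epsilon\|_\infty=\max_\alpha|\epsilon_\alpha|$. $\mathcal{M}(\Omega)$ is the space of signed Radon measures on $\Omega$ with finite total variation, $\|\cdot\|_{\mathrm{TV}}$ the total variation norm. $A$ is the matrix indexed by $\{\alpha\in\mathbb{Z}_+^d:\|\alpha\|_1\le k\}$ with $A_{\alpha,\alpha'}=\alpha_i(\alpha_i-1)$ if $\alpha'=\alpha-2e_i$ for some $i$, and $0$ otherwise. Problem $(P_{\Omega,k})$: minimize $\|u_0\|_{\mathrm{TV}}$ over $u_0\in\mathcal{M}(\Omega)$ subject to $\int_\Omega x^\alpha\,du_0(x)=(e^{-TA}\mathbf{y})_\alpha$ for all $\|\alpha\|_1\le k$. Kantorovich norm: for $\mu\in\mathcal{M}(\Omega)$, $\|\mu\|_{\mathrm{Kant}}=\max\{\int_\Omega v\,d\mu: v\in\mathcal{C}(\Omega),\ \sup_\Omega|v|\le 1,\ \mathrm{Lip}(v)\le 1\}$, with Lipschitz constant w.r.t. the Euclidean norm. *)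

theory Defs
  imports "HOL-Analysis.Analysis"
begin

text \<open>A signed Radon measure with finite total variation on R^d (d = CARD('n)) is
represented as a pair (P, N) of finite Borel measures; the signed measure is P - N.\<close>

type_synonym 'n sm = "(real^'n) measure \<times> (real^'n) measure"

definition is_fsm :: "('n::finite) sm \<Rightarrow> bool" where
  "is_fsm \<mu> \<longleftrightarrow> sets (fst \<mu>) = sets borel \<and> sets (snd \<mu>) = sets borel
     \<and> finite_measure (fst \<mu>) \<and> finite_measure (snd \<mu>)"

definition sm_val :: "('n::finite) sm \<Rightarrow> (real^'n) set \<Rightarrow> real" where
  "sm_val \<mu> A = measure (fst \<mu>) A - measure (snd \<mu>) A"

definition sm_int :: "('n::finite) sm \<Rightarrow> (real^'n \<Rightarrow> real) \<Rightarrow> real" where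
  "sm_int \<mu> f = (\<integral>x. f x \<partial>(fst \<mu>)) - (\<integral>x. f x \<partial>(snd \<mu>))"

definition sm_supp_in :: "('n::finite) sm \<Rightarrow> (real^'n) set \<Rightarrow> bool" where
  "sm_supp_in \<mu> S \<longleftrightarrow> (\<forall>A\<in>sets borel. A \<inter> S = {} \<longrightarrow> sm_val \<mu> A = 0)"

definition tv_norm :: "('n::finite) sm \<Rightarrow> real" where
  "tv_norm \<mu> = Sup {(\<Sum>A\<in>F. \<bar>sm_val \<mu> A\<bar>) | F. finite F \<and> disjoint F \<and> F \<subseteq> sets borel}"

definition cube :: "real \<Rightarrow> (real^'n::finite) set" where
  "cube R = {x. \<forall>i. \<bar>x $ i\<bar> \<le> R}"

definition multi_idx :: "nat \<Rightarrow> ('n::finite \<Rightarrow> nat) set" where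
  "multi_idx k = {\<alpha>. (\<Sum>i\<in>UNIV. \<alpha> i) \<le> k}"

definition mono_pow :: "('n::finite \<Rightarrow> nat) \<Rightarrow> real^'n \<Rightarrow> real" where
  "mono_pow \<alpha> x = (\<Prod>i\<in>UNIV. (x $ i) ^ (\<alpha> i))"

definition heat_kernel :: "real^'n::finite \<Rightarrow> real \<Rightarrow> real" where
  "heat_kernel x t = (4 * pi * t) powr (- real CARD('n) / 2) * exp (- (norm x)\<^sup>2 / (4 * t))"

definition heat_sol :: "('n::finite) sm \<Rightarrow> real^'n \<Rightarrow> real \<Rightarrow> real" where
  "heat_sol \<mu> x t = sm_int \<mu> (\<lambda>z. heat_kernel (x - z) t)"

definition A_entry :: "('n::finite \<Rightarrow> nat) \<Rightarrow> ('n \<Rightarrow> nat) \<Rightarrow> real" where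
  "A_entry \<alpha> \<alpha>' = (\<Sum>i\<in>UNIV. if 2 \<le> \<alpha> i \<and> \<alpha>' = \<alpha>(i := \<alpha> i - 2)
                                  then real (\<alpha> i * (\<alpha> i - 1)) else 0)"

definition A_apply :: "nat \<Rightarrow> (('n::finite \<Rightarrow> nat) \<Rightarrow> real) \<Rightarrow> ('n \<Rightarrow> nat) \<Rightarrow> real" where
  "A_apply k v \<alpha> = (\<Sum>\<alpha>'\<in>multi_idx k. A_entry \<alpha> \<alpha>' * v \<alpha>')"

definition expmA :: "nat \<Rightarrow> real \<Rightarrow> (('n::finite \<Rightarrow> nat) \<Rightarrow> real) \<Rightarrow> ('n \<Rightarrow> nat) \<Rightarrow> real" where
  "expmA k T y \<alpha> = (\<Sum>j. ((- T) ^ j / fact j) * ((A_apply k ^^ j) y) \<alpha>)"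

definition Pk_feasible :: "real \<Rightarrow> nat \<Rightarrow> real \<Rightarrow> (('n::finite \<Rightarrow> nat) \<Rightarrow> real) \<Rightarrow> 'n sm \<Rightarrow> bool" where
  "Pk_feasible R k T y \<mu> \<longleftrightarrow> is_fsm \<mu> \<and> sm_supp_in \<mu> (cube R) \<and>
     (\<forall>\<alpha>\<in>multi_idx k. sm_int \<mu> (\<lambda>x. indicator (cube R) x * mono_pow \<alpha> x) = expmA k T y \<alpha>)"

definition Pk_solution :: "real \<Rightarrow> nat \<Rightarrow> real \<Rightarrow> (('n::finite \<Rightarrow> nat) \<Rightarrow> real) \<Rightarrow> 'n sm \<Rightarrow> bool" where
  "Pk_solution R k T y \<mu> \<longleftrightarrow> Pk_feasible R k T y \<mu> \<and>
     (\<forall>\<nu>. Pk_feasible R k T y \<nu> \<longrightarrow> tv_norm \<mu> \<le> tv_norm \<nu>)"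

definition kant_norm_diff :: "(real^'n::finite) set \<Rightarrow> 'n sm \<Rightarrow> 'n sm \<Rightarrow> real" where
  "kant_norm_diff S \<mu> \<nu> = Sup {sm_int \<mu> (\<lambda>x. indicator S x * v x) - sm_int \<nu> (\<lambda>x. indicator S x * v x) | v.
      continuous_on S v \<and> (\<forall>x\<in>S. \<bar>v x\<bar> \<le> 1) \<and> lipschitz_on 1 S v}"

definition obs_err :: "nat \<Rightarrow> real \<Rightarrow> (('n::finite \<Rightarrow> nat) \<Rightarrow> real) \<Rightarrow> 'n sm \<Rightarrow> ('n \<Rightarrow> nat) \<Rightarrow> real" where
  "obs_err k T y u0 \<alpha> = y \<alpha> - (\<integral>x. mono_pow \<alpha> x * heat_sol u0 x T \<partial>lborel)"

definition sup_norm_idx :: "nat \<Rightarrow> (('n::finite \<Rightarrow> nat) \<Rightarrow> real) \<Rightarrow> real" where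
  "sup_norm_idx k e = Max ((\<lambda>\<alpha>. \<bar>e \<alpha>\<bar>) ` multi_idx k)"

end

(*
  The measures u_0^k and u_0^* have moments on the cube that differ by m = exp(-T A) epsilon.
  Interpolation at a tensor grid of Chebyshev nodes produces a finitely supported measure nu on the
  cube with exactly these moments for |alpha| <= k, whose mass is bounded by the coefficients of the
  Chebyshev polynomials.  Since u_0^* + nu is feasible, minimality gives
  ||u_0^k||_TV <= ||u_0^*||_TV + ||nu||_TV.  A test function v is split as v(0) + p + r, with p a
  polynomial of total degree at most k satisfying |r| = O(R / k) and |p| <= d R (a positive
  Jackson-type operator): r is integrated against the total variations, p against nu, and the
  constant v(0) only sees epsilon_0.
*)

theory Submission
  imports Defs "HOL-Probability.Distributions"
begin

section \<open>Chebyshev polynomials and coefficient functionals\<close>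

text \<open>The difficulty lies in the constants: C may depend on d only, and sqrt(k/pi) comes
  without a free constant. Hence the split at v(0): the rest is bounded by d R, so the mass of nu
  enters with a factor R, as in the term with C R, while epsilon_0 enters with coefficient 1 and
  fits under sqrt(k/pi) times the exponential. That exponential is spent as follows: sqrt(k)^k and
  2^k come from exp(-T A), exp(d k/R) from the Chebyshev coefficients (one factor exp(k/R) per
  coordinate), and the gap between 2^k and exp(k) absorbs the polynomial factors in k. Positivity of
  the Jackson operator bounds p on the cube by the sup of the function with constant 1; as nu sits
  at points of the cube, pairing p with nu needs these values only, never the coefficients of p. A
  signed measure is a difference of finite measures that may overlap and may charge the complement
  of the cube with cancelling masses. Integrals are therefore estimated through partitions, and
  moments are cut off to the cube before integrals are exchanged.\<close>

fun cheb :: "nat \<Rightarrow> real poly" where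
  "cheb 0 = 1"
| "cheb (Suc 0) = [:0, 1:]"
| "cheb (Suc (Suc n)) = [:0, 2:] * cheb (Suc n) - cheb n"

lemma poly_cheb_cos: "poly (cheb n) (cos t) = cos (real n * t)"
proof (induction n rule: cheb.induct)
  case (3 n)
  have "cos (real (Suc (Suc n)) * t) + cos (real n * t) = 2 * cos t * cos (real (Suc n) * t)"
    using cos_add[of "real (Suc n) * t" t] cos_diff[of "real (Suc n) * t" t]
    by (simp add: algebra_simps)
  then show ?case using 3 by (simp add: algebra_simps)
qed simp_all

lemma degree_cheb: "degree (cheb n) \<le> n"
proof (induction n rule: cheb.induct)
  case (3 n)
  have "degree ([:0, 2:] * cheb (Suc n)) \<le> Suc (Suc n)"
    using degree_mult_le[of "[:0, 2::real:]" "cheb (Suc n)"] 3(1) by simp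
  then show ?case using 3(2) by (simp add: degree_diff_le)
qed simp_all

lemma coeff_cheb_Suc_Suc:
  "coeff (cheb (Suc (Suc n))) m
     = (if m = 0 then 0 else 2 * coeff (cheb (Suc n)) (m - 1)) - coeff (cheb n) m"
  by (cases m) simp_all

lemma lead_coeff_cheb: "coeff (cheb n) n > 0"
proof (induction n rule: cheb.induct)
  case (3 n)
  have "coeff (cheb n) (Suc (Suc n)) = 0"
    by (rule coeff_eq_0) (use degree_cheb[of n] in simp)
  then show ?case using 3 unfolding coeff_cheb_Suc_Suc by simp
qed simp_all

lemma cheb_span:
  assumes "degree p \<le> n"
  shows "\<exists>a. p = (\<Sum>r\<le>n. smult (a r) (cheb r))"
  using assms
proof (induction n arbitrary: p)
  case 0
  then obtain c where "p = [:c:]" by (metis degree_eq_zeroE le_zero_eq)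
  then show ?case by (intro exI[of _ "\<lambda>_. c"]) simp
next
  case (Suc n)
  define c where "c = coeff p (Suc n) / coeff (cheb (Suc n)) (Suc n)"
  define q where "q = p - smult c (cheb (Suc n))"
  have "degree q \<le> n"
  proof (rule degree_le, intro allI impI)
    fix i assume "n < i"
    show "coeff q i = 0"
    proof (cases "i = Suc n")
      case True
      then show ?thesis using lead_coeff_cheb[of "Suc n"] by (simp add: q_def c_def)
    next
      case False
      then have "Suc n < i" using \<open>n < i\<close> by simp
      then show ?thesis
        using Suc.prems degree_cheb[of "Suc n"] by (simp add: q_def coeff_eq_0)
    qed
  qed
  from Suc.IH[OF this] obtain a where a: "q = (\<Sum>r\<le>n. smult (a r) (cheb r))" by blast
  have "p = q + smult c (cheb (Suc n))" by (simp add: q_def)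
  also have "\<dots> = (\<Sum>r\<le>Suc n. smult ((a(Suc n := c)) r) (cheb r))"
    by (simp add: a)
  finally show ?case by blast
qed

text \<open>In absolute values the recurrence becomes a(n+2) \<le> 2 s a(n+1) + a(n), and exp (n s)
  dominates it because 2 s + exp (- s) \<le> exp s, that is s \<le> sinh s. The cutoff
  \<open>K\<close> is arbitrary in the induction since multiplication by the variable shifts it by
  one.\<close>

lemma sum_abs_coeff_cheb_le:
  assumes "0 \<le> s"
  shows "(\<Sum>m\<le>K. \<bar>coeff (cheb n) m\<bar> * s ^ m) \<le> exp (real n * s)"
proof (induction n arbitrary: K rule: cheb.induct)
  case 1
  have "(\<Sum>m\<le>K. \<bar>coeff (cheb 0) m\<bar> * s ^ m) = (\<Sum>m\<in>{0}. \<bar>coeff (cheb 0) m\<bar> * s ^ m)"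
    by (rule sum.mono_neutral_right) (auto simp: gr0_conv_Suc)
  then show ?case by simp
next
  case 2
  have "(\<Sum>m\<le>K. \<bar>coeff (cheb (Suc 0)) m\<bar> * s ^ m) = (\<Sum>m\<le>K. if m = 1 then s else 0)"
    by (rule sum.cong) (auto simp: coeff_pCons split: nat.splits)
  also have "\<dots> \<le> s" using assms by simp
  also have "s \<le> exp s" using exp_ge_add_one_self[of s] by linarith
  finally show ?case by simp
next
  case (3 n)
  have *: "(\<Sum>m\<le>K. (if m = 0 then 0 else 2 * \<bar>coeff (cheb (Suc n)) (m - 1)\<bar>) * s ^ m)
             \<le> 2 * s * exp (real (Suc n) * s)"
  proof (cases K)
    case 0
    then show ?thesis using assms by simp
  next
    case (Suc K')
    have "(\<Sum>m\<le>K. (if m = 0 then 0 else 2 * \<bar>coeff (cheb (Suc n)) (m - 1)\<bar>) * s ^ m)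
            = 2 * s * (\<Sum>m\<le>K'. \<bar>coeff (cheb (Suc n)) m\<bar> * s ^ m)"
      unfolding Suc sum.atMost_Suc_shift by (simp add: sum_distrib_left mult_ac)
    also have "\<dots> \<le> 2 * s * exp (real (Suc n) * s)"
      using 3(1)[of K'] assms by (intro mult_left_mono) auto
    finally show ?thesis .
  qed
  have sinh: "2 * s + exp (- s) \<le> exp s"
  proof -
    have "s \<le> sinh s"
      using DERIV_nonneg_imp_nondecreasing[of 0 s "\<lambda>x. sinh x - x"] assms
        cosh_real_ge_1 by (fastforce intro!: derivative_eq_intros)
    then show ?thesis by (simp add: sinh_def)
  qed
  have "(\<Sum>m\<le>K. \<bar>coeff (cheb (Suc (Suc n))) m\<bar> * s ^ m)
      \<le> (\<Sum>m\<le>K. (if m = 0 then 0 else 2 * \<bar>coeff (cheb (Suc n)) (m - 1)\<bar>) * s ^ m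
            + \<bar>coeff (cheb n) m\<bar> * s ^ m)"
  proof (rule sum_mono)
    fix m
    have "\<bar>coeff (cheb (Suc (Suc n))) m\<bar>
        \<le> (if m = 0 then 0 else 2 * \<bar>coeff (cheb (Suc n)) (m - 1)\<bar>) + \<bar>coeff (cheb n) m\<bar>"
      unfolding coeff_cheb_Suc_Suc by auto
    then show "\<bar>coeff (cheb (Suc (Suc n))) m\<bar> * s ^ m
        \<le> (if m = 0 then 0 else 2 * \<bar>coeff (cheb (Suc n)) (m - 1)\<bar>) * s ^ m
            + \<bar>coeff (cheb n) m\<bar> * s ^ m"
      using assms by (metis distrib_right mult_right_mono zero_le_power)
  qed
  also have "\<dots> \<le> 2 * s * exp (real (Suc n) * s) + exp (real n * s)"
    unfolding sum.distrib using * 3(2)[of K] by (rule add_mono)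
  also have "\<dots> = exp (real (Suc n) * s) * (2 * s + exp (- s))"
    by (simp add: algebra_simps flip: exp_add)
  also have "\<dots> \<le> exp (real (Suc n) * s) * exp s"
    by (intro mult_left_mono sinh) simp
  also have "\<dots> = exp (real (Suc (Suc n)) * s)"
    by (simp add: algebra_simps flip: exp_add)
  finally show ?case .
qed

section \<open>Discrete orthogonality at the Chebyshev nodes\<close>

definition cheb_angle :: "nat \<Rightarrow> nat \<Rightarrow> real" where
  "cheb_angle N j = (2 * real j + 1) * pi / (2 * real N)"

definition cheb_node :: "nat \<Rightarrow> nat \<Rightarrow> real" where
  "cheb_node N j = cos (cheb_angle N j)"

lemma abs_cheb_node_le_1: "\<bar>cheb_node N j\<bar> \<le> 1"
  by (simp add: cheb_node_def abs_le_iff cos_ge_minus_one minus_le_iff)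

text \<open>Multiplying by 2 sin b makes the sum telescope to sin (m pi) = 0. The bound m < 2 N
  places b strictly between 0 and pi, so sin b can be cancelled.\<close>

lemma sum_cos_cheb_angle:
  assumes "0 < m" "m < 2 * N"
  shows "(\<Sum>j<N. cos (real m * cheb_angle N j)) = 0"
proof -
  define b where "b = real m * pi / (2 * real N)"
  have N: "0 < N" using assms by simp
  have "0 < b" "b < pi"
    using assms by (auto simp: b_def field_simps)
  then have sb: "sin b > 0" by (rule sin_gt_zero)
  have "2 * sin b * (\<Sum>j<N. cos (real m * cheb_angle N j))
      = (\<Sum>j<N. sin (2 * real (Suc j) * b) - sin (2 * real j * b))"
    unfolding sum_distrib_left
  proof (rule sum.cong, rule refl)
    fix j
    have e: "real m * cheb_angle N j = (2 * real j + 1) * b"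
      by (simp add: cheb_angle_def b_def)
    show "2 * sin b * cos (real m * cheb_angle N j)
        = sin (2 * real (Suc j) * b) - sin (2 * real j * b)"
      unfolding e
      using sin_add[of "(2 * real j + 1) * b" b] sin_diff[of "(2 * real j + 1) * b" b]
      by (simp add: algebra_simps)
  qed
  also have "\<dots> = sin (2 * real N * b) - sin (2 * real 0 * b)"
    by (rule sum_lessThan_telescope)
  also have "2 * real N * b = real m * pi" using N by (simp add: b_def)
  finally show ?thesis using sb by simp
qed

text \<open>The product formula for cosines leaves the frequencies m + r and |m - r|, both below 2
  N; each sum vanishes unless its frequency is 0. The case r \<le> m comes first because of the
  truncated subtraction.\<close>

lemma cheb_orthogonal:
  assumes "m + r < 2 * N"
  shows "(\<Sum>j<N. cos (real m * cheb_angle N j) * cos (real r * cheb_angle N j))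
           = (if m = r then if m = 0 then real N else real N / 2 else 0)"
proof -
  have *: "(\<Sum>j<N. cos (real m * cheb_angle N j) * cos (real r * cheb_angle N j))
      = (\<Sum>j<N. cos (real (m + r) * cheb_angle N j)) / 2 + (\<Sum>j<N. cos (real (m - r) * cheb_angle N j)) / 2"
    if "r \<le> m" "m + r < 2 * N" for m r
    unfolding sum_divide_distrib sum.distrib[symmetric] using that
    by (intro sum.cong refl) (simp add: cos_times_cos add_divide_distrib algebra_simps of_nat_diff)
  have **: "(\<Sum>j<N. cos (real m * cheb_angle N j) * cos (real r * cheb_angle N j))
           = (if m = r then if m = 0 then real N else real N / 2 else 0)"
    if "r \<le> m" "m + r < 2 * N" for m r
  proof (cases "m = r")
    case True
    then show ?thesis
      unfolding *[OF that] using sum_cos_cheb_angle[of "m + r" N] that by (cases "m = 0") auto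
  next
    case False
    then show ?thesis
      unfolding *[OF that] using sum_cos_cheb_angle[of "m + r" N] sum_cos_cheb_angle[of "m - r" N] that
      by auto
  qed
  show ?thesis
  proof (cases "r \<le> m")
    case True
    then show ?thesis using **[of r m] assms by simp
  next
    case False
    then show ?thesis using **[of m r] assms by (auto simp: mult.commute)
  qed
qed

text \<open>\<open>coeff_weight K m\<close> are the weights on the \<open>K + 1\<close> Chebyshev nodes that return the \<open>m\<close>-th monomial
  coefficient of any polynomial of degree at most \<open>K\<close>: the Chebyshev coefficients are recovered by
  discrete orthogonality and then converted to the monomial basis.\<close>

definition coeff_weight :: "nat \<Rightarrow> nat \<Rightarrow> nat \<Rightarrow> real" where
  "coeff_weight K m j = (\<Sum>r\<le>K. coeff (cheb r) m *
      ((if r = 0 then 1 else 2) / real (Suc K) * cos (real r * cheb_angle (Suc K) j)))"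

text \<open>With K + 1 nodes any two degrees up to K add up to less than 2 (K + 1), so orthogonality
  holds for all pairs; the factors 1 and 2 over K + 1 invert the squared norms K + 1 and (K + 1) /
  2.\<close>

lemma sum_coeff_weight_poly:
  assumes "degree p \<le> K"
  shows "(\<Sum>j<Suc K. coeff_weight K m j * poly p (cheb_node (Suc K) j)) = coeff p m"
proof -
  obtain a where a: "p = (\<Sum>r\<le>K. smult (a r) (cheb r))" using cheb_span[OF assms] by blast
  let ?c = "\<lambda>r j. cos (real r * cheb_angle (Suc K) j)"
  have ev: "poly p (cheb_node (Suc K) j) = (\<Sum>r\<le>K. a r * ?c r j)" for j
    by (simp add: a poly_sum cheb_node_def poly_cheb_cos)
  have coef: "(\<Sum>j<Suc K. ?c r j * poly p (cheb_node (Suc K) j))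
      = (if r = 0 then real (Suc K) else real (Suc K) / 2) * a r" if "r \<le> K" for r
  proof -
    have "(\<Sum>j<Suc K. ?c r j * poly p (cheb_node (Suc K) j))
        = (\<Sum>q\<le>K. a q * (\<Sum>j<Suc K. ?c r j * ?c q j))"
      unfolding ev sum_distrib_left by (subst sum.swap) (simp add: mult_ac)
    also have "\<dots> = (\<Sum>q\<le>K. if q = r then (if r = 0 then real (Suc K) else real (Suc K) / 2) * a r else 0)"
      using that by (intro sum.cong refl) (subst cheb_orthogonal, auto)
    finally show ?thesis using that by simp
  qed
  have "(\<Sum>j<Suc K. coeff_weight K m j * poly p (cheb_node (Suc K) j))
      = (\<Sum>r\<le>K. coeff (cheb r) m * ((if r = 0 then 1 else 2) / real (Suc K)) *
            (\<Sum>j<Suc K. ?c r j * poly p (cheb_node (Suc K) j)))"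
    unfolding coeff_weight_def sum_distrib_right sum_distrib_left
    by (subst sum.swap) (simp add: mult_ac)
  also have "\<dots> = (\<Sum>r\<le>K. coeff (cheb r) m * a r)"
    by (intro sum.cong refl) (simp add: coef del: of_nat_Suc sum.lessThan_Suc)
  also have "\<dots> = coeff p m" by (simp add: a coeff_sum mult.commute)
  finally show ?thesis .
qed

lemma sum_coeff_weight_power:
  assumes "l \<le> K"
  shows "(\<Sum>j<Suc K. coeff_weight K m j * cheb_node (Suc K) j ^ l) = (if l = m then 1 else 0)"
  using sum_coeff_weight_poly[of "monom 1 l" K m] assms
  by (simp add: poly_monom degree_monom_eq del: sum.lessThan_Suc)

text \<open>Since |cos| \<le> 1, each node contributes at most 2 / (K + 1) per Chebyshev polynomial,
  which the sum over the K + 1 nodes turns into 2. The remaining K + 1 comes from the number of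
  polynomials, each bounded by exp (K s).\<close>

lemma sum_abs_coeff_weight_le:
  assumes "0 \<le> s"
  shows "(\<Sum>m\<le>K. (\<Sum>j<Suc K. \<bar>coeff_weight K m j\<bar>) * s ^ m) \<le> 2 * real (Suc K) * exp (real K * s)"
proof -
  have 1: "\<bar>coeff_weight K m j\<bar> \<le> (\<Sum>r\<le>K. \<bar>coeff (cheb r) m\<bar> * (2 / real (Suc K)))" for m j
    unfolding coeff_weight_def
  proof (intro order_trans[OF sum_abs] sum_mono)
    fix r
    have "\<bar>(if r = 0 then 1 else 2) / real (Suc K) * cos (real r * cheb_angle (Suc K) j)\<bar>
        \<le> 2 / real (Suc K) * 1"
      unfolding abs_mult by (intro mult_mono) (auto simp: divide_right_mono abs_cos_le_one)
    then show "\<bar>coeff (cheb r) m * ((if r = 0 then 1 else 2) / real (Suc K) * cos (real r * cheb_angle (Suc K) j))\<bar>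
        \<le> \<bar>coeff (cheb r) m\<bar> * (2 / real (Suc K))"
      unfolding abs_mult[of "coeff (cheb r) m"] by (intro mult_left_mono) auto
  qed
  have 2: "(\<Sum>j<Suc K. \<bar>coeff_weight K m j\<bar>) \<le> 2 * (\<Sum>r\<le>K. \<bar>coeff (cheb r) m\<bar>)" for m
  proof -
    have "(\<Sum>j<Suc K. \<bar>coeff_weight K m j\<bar>) \<le> (\<Sum>j<Suc K. \<Sum>r\<le>K. \<bar>coeff (cheb r) m\<bar> * (2 / real (Suc K)))"
      by (intro sum_mono 1)
    also have "\<dots> = 2 * (\<Sum>r\<le>K. \<bar>coeff (cheb r) m\<bar>)"
      by (simp add: sum_distrib_left del: of_nat_Suc sum.lessThan_Suc)
        (simp add: sum_distrib_left mult_ac)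
    finally show ?thesis .
  qed
  have "(\<Sum>m\<le>K. (\<Sum>j<Suc K. \<bar>coeff_weight K m j\<bar>) * s ^ m)
      \<le> (\<Sum>m\<le>K. 2 * (\<Sum>r\<le>K. \<bar>coeff (cheb r) m\<bar>) * s ^ m)"
    by (intro sum_mono mult_right_mono 2) (use assms in simp)
  also have "\<dots> = 2 * (\<Sum>r\<le>K. \<Sum>m\<le>K. \<bar>coeff (cheb r) m\<bar> * s ^ m)"
    by (subst sum.swap) (simp add: sum_distrib_left sum_distrib_right mult_ac)
  also have "\<dots> \<le> 2 * (\<Sum>r\<le>K. exp (real K * s))"
  proof (intro mult_left_mono sum_mono)
    fix r assume "r \<in> {..K}"
    have "(\<Sum>m\<le>K. \<bar>coeff (cheb r) m\<bar> * s ^ m) \<le> exp (real r * s)"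
      by (rule sum_abs_coeff_cheb_le[OF assms])
    also have "\<dots> \<le> exp (real K * s)" using \<open>r \<in> {..K}\<close> assms by (simp add: mult_right_mono)
    finally show "(\<Sum>m\<le>K. \<bar>coeff (cheb r) m\<bar> * s ^ m) \<le> exp (real K * s)" .
  qed simp
  finally show ?thesis by (simp only: sum_constant card_atMost mult.assoc)
qed

section \<open>A Jackson-type kernel on Chebyshev nodes\<close>

text \<open>The absolute difference is kept in the naturals because it serves as the index of a
  Chebyshev polynomial.\<close>

definition nat_dist :: "nat \<Rightarrow> nat \<Rightarrow> nat" where
  "nat_dist l l' = (l - l') + (l' - l)"

text \<open>The first Dirichlet eigenvector of the path 1, ..., n + 1 with boundary points 0 and n +
  2.\<close>

definition jackson_coeff :: "nat \<Rightarrow> nat \<Rightarrow> real" where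
  "jackson_coeff n l = sin (real l * (pi / real (n + 2)))"

definition jackson_mass :: "nat \<Rightarrow> real" where
  "jackson_mass n = (\<Sum>l\<in>{1..n+1}. (jackson_coeff n l)\<^sup>2)"

text \<open>With \<open>a\<close> the coefficients \<open>jackson_coeff n\<close>, the even part of the Fejer-Korovkin kernel
  \<open>|\<Sum>l. a\<^sub>l e\<^sup>i\<^sup>l\<^sup>u|\<^sup>2\<close> at \<open>u = t - cheb_angle (n + 2) j\<close>, written as a polynomial in
  \<open>cos t\<close> and normalised to sum to 1 over the nodes.  The sine coefficients vanish at both ends
  \<open>0\<close> and \<open>n + 2\<close>, which makes the variance \<open>O(1 / n\<^sup>2)\<close>.\<close>

definition jackson_poly :: "nat \<Rightarrow> nat \<Rightarrow> real poly" where
  "jackson_poly n j = smult (1 / (real (n + 2) * jackson_mass n))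
     (\<Sum>l\<in>{1..n+1}. \<Sum>l'\<in>{1..n+1}.
        smult (jackson_coeff n l * jackson_coeff n l' * cos (real (nat_dist l l') * cheb_angle (n + 2) j))
          (cheb (nat_dist l l')))"

text \<open>Autocorrelation of the coefficients at lag r; for r > 0 both orders of a pair are
  counted, so it is twice the one-sided value.\<close>

definition jackson_corr :: "nat \<Rightarrow> nat \<Rightarrow> real" where
  "jackson_corr n r = (\<Sum>l\<in>{1..n+1}. \<Sum>l'\<in>{1..n+1}.
      if nat_dist l l' = r then jackson_coeff n l * jackson_coeff n l' else 0)"

lemma jackson_coeff_pos: "l \<in> {1..n+1} \<Longrightarrow> jackson_coeff n l > 0"
proof -
  assume l: "l \<in> {1..n+1}"
  then have "pi * real l < pi * real (n + 2)" by (intro mult_strict_left_mono) auto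
  then show ?thesis
    unfolding jackson_coeff_def using l by (intro sin_gt_zero) (auto simp: field_simps)
qed

lemma jackson_mass_pos: "jackson_mass n > 0"
  unfolding jackson_mass_def
proof (rule sum_pos)
  fix l assume "l \<in> {1..n+1}"
  from jackson_coeff_pos[OF this] show "(jackson_coeff n l)\<^sup>2 > 0" by simp
qed auto

lemma degree_jackson_poly: "degree (jackson_poly n j) \<le> n"
  unfolding jackson_poly_def
proof (intro order_trans[OF degree_smult_le] degree_sum_le)
  fix l l' assume "l \<in> {1..n+1}" "l' \<in> {1..n+1}"
  then have "nat_dist l l' \<le> n" by (auto simp: nat_dist_def)
  then show "degree (cheb (nat_dist l l')) \<le> n"
    using degree_cheb[of "nat_dist l l'"] by linarith
qed auto

lemma poly_jackson_poly:
  "poly (jackson_poly n j) (cos t) = 1 / (real (n + 2) * jackson_mass n) *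
     (\<Sum>l\<in>{1..n+1}. \<Sum>l'\<in>{1..n+1}. jackson_coeff n l * jackson_coeff n l' *
        (cos (real (nat_dist l l') * cheb_angle (n + 2) j) * cos (real (nat_dist l l') * t)))"
  by (simp add: jackson_poly_def poly_sum poly_cheb_cos mult_ac
      del: of_nat_Suc of_nat_add sum.cl_ivl_Suc)

lemma cos_nat_dist: "cos (real (nat_dist l l') * t) = cos (real l * t - real l' * t)"
proof (cases "l' \<le> l")
  case True
  then have "real (nat_dist l l') * t = real l * t - real l' * t"
    by (simp add: nat_dist_def of_nat_diff algebra_simps)
  then show ?thesis by simp
next
  case False
  then have "real (nat_dist l l') * t = - (real l * t - real l' * t)"
    by (simp add: nat_dist_def of_nat_diff algebra_simps)
  then show ?thesis by (simp only: cos_minus)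
qed

text \<open>A product of cosines is the mean of the cosines at b - t and b + t. At each of these
  angles the double sum is a squared modulus, written out as the square of a cosine sum plus the
  square of a sine sum.\<close>

lemma jackson_poly_nonneg:
  assumes "\<bar>x\<bar> \<le> 1"
  shows "0 \<le> poly (jackson_poly n j) x"
proof -
  obtain t where x: "x = cos t" using assms by (metis abs_le_iff cos_arccos minus_le_iff)
  let ?a = "jackson_coeff n" and ?I = "{1..n+1}" and ?b = "cheb_angle (n + 2) j"
  have sq: "0 \<le> (\<Sum>l\<in>?I. \<Sum>l'\<in>?I. ?a l * ?a l' * cos (real (nat_dist l l') * u))" for u
  proof -
    have "(\<Sum>l\<in>?I. \<Sum>l'\<in>?I. ?a l * ?a l' * cos (real (nat_dist l l') * u))
        = (\<Sum>l\<in>?I. ?a l * cos (real l * u))\<^sup>2 + (\<Sum>l\<in>?I. ?a l * sin (real l * u))\<^sup>2"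
      unfolding power2_eq_square sum_product sum.distrib[symmetric]
      by (intro sum.cong refl) (simp only: cos_nat_dist cos_diff, simp add: algebra_simps)
    then show ?thesis by simp
  qed
  have "(\<Sum>l\<in>?I. \<Sum>l'\<in>?I. ?a l * ?a l' * (cos (real (nat_dist l l') * ?b) * cos (real (nat_dist l l') * t)))
    = ((\<Sum>l\<in>?I. \<Sum>l'\<in>?I. ?a l * ?a l' * cos (real (nat_dist l l') * (?b - t)))
      + (\<Sum>l\<in>?I. \<Sum>l'\<in>?I. ?a l * ?a l' * cos (real (nat_dist l l') * (?b + t)))) / 2"
    unfolding sum.distrib[symmetric] sum_divide_distrib
    by (intro sum.cong refl) (simp only: right_diff_distrib distrib_left cos_add cos_diff, simp add: algebra_simps)
  moreover have "\<dots> \<ge> 0" by (intro divide_nonneg_nonneg add_nonneg_nonneg sq) simp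
  ultimately show ?thesis
    unfolding x poly_jackson_poly using jackson_mass_pos[of n] by simp
qed

text \<open>The kernel has frequencies up to n, so together with r \<le> 2 they stay below 2 (n +
  2), and the sum over the nodes picks out exactly the pairs at lag r. Lags 0, 1, 2 are what a
  variance requires; the factor 1/2 is the norm of a nonconstant cosine.\<close>

lemma jackson_moment:
  assumes "r \<le> 2"
  shows "(\<Sum>j<n+2. poly (jackson_poly n j) (cos t) * cos (real r * cheb_angle (n + 2) j))
    = (if r = 0 then 1 else 1 / 2) * jackson_corr n r / jackson_mass n * cos (real r * t)"
proof -
  let ?a = "jackson_coeff n" and ?I = "{1..n+1}" and ?b = "cheb_angle (n + 2)"
  have "(\<Sum>j<n+2. poly (jackson_poly n j) (cos t) * cos (real r * ?b j))
    = 1 / (real (n + 2) * jackson_mass n) * (\<Sum>j<n+2. \<Sum>l\<in>?I. \<Sum>l'\<in>?I.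
        ?a l * ?a l' * cos (real (nat_dist l l') * t) *
         (cos (real (nat_dist l l') * ?b j) * cos (real r * ?b j)))"
    unfolding poly_jackson_poly sum_distrib_left sum_distrib_right
    by (intro sum.cong refl) (simp only: mult_ac)
  also have "(\<Sum>j<n+2. \<Sum>l\<in>?I. \<Sum>l'\<in>?I.
        ?a l * ?a l' * cos (real (nat_dist l l') * t) *
         (cos (real (nat_dist l l') * ?b j) * cos (real r * ?b j)))
    = (\<Sum>l\<in>?I. \<Sum>l'\<in>?I. ?a l * ?a l' * cos (real (nat_dist l l') * t) *
        (\<Sum>j<n+2. cos (real (nat_dist l l') * ?b j) * cos (real r * ?b j)))"
    unfolding sum_distrib_left by (rule trans[OF sum.swap], rule sum.cong, rule refl, rule sum.swap)
  also have "\<dots> = (\<Sum>l\<in>?I. \<Sum>l'\<in>?I. (if r = 0 then 1 else 1 / 2) * real (n + 2) * cos (real r * t) *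
       (if nat_dist l l' = r then ?a l * ?a l' else 0))"
  proof (intro sum.cong refl)
    fix l l' assume "l \<in> ?I" "l' \<in> ?I"
    then have "nat_dist l l' + r < 2 * (n + 2)" using assms by (auto simp: nat_dist_def)
    from cheb_orthogonal[OF this]
    show "?a l * ?a l' * cos (real (nat_dist l l') * t) *
        (\<Sum>j<n+2. cos (real (nat_dist l l') * ?b j) * cos (real r * ?b j))
      = (if r = 0 then 1 else 1 / 2) * real (n + 2) * cos (real r * t) *
       (if nat_dist l l' = r then ?a l * ?a l' else 0)"
      by (simp del: sum.lessThan_Suc)
  qed
  also have "\<dots> = (if r = 0 then 1 else 1 / 2) * real (n + 2) * cos (real r * t) * jackson_corr n r"
    unfolding jackson_corr_def sum_distrib_left ..
  finally have "(\<Sum>j<n+2. poly (jackson_poly n j) (cos t) * cos (real r * ?b j))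
    = 1 / (real (n + 2) * jackson_mass n) *
      ((if r = 0 then 1 else 1 / 2) * real (n + 2) * cos (real r * t) * jackson_corr n r)" .
  moreover have "1 / (q * m) * (c * q * x * y) = c * y / m * x" if "q \<noteq> 0" for q m c x y :: real
    using that by simp
  ultimately show ?thesis by (simp only: of_nat_eq_0_iff add_is_0) simp
qed

text \<open>The two neighbours l - r and l + r are distinct because r > 0, so neither is counted
  twice; the guards remove a neighbour outside the range.\<close>

lemma sum_nat_dist_eq:
  fixes f :: "nat \<Rightarrow> real"
  assumes "l \<in> {1..m}" "r > 0"
  shows "(\<Sum>l'\<in>{1..m}. if nat_dist l l' = r then f l' else 0)
    = (if r < l then f (l - r) else 0) + (if l + r \<le> m then f (l + r) else 0)"
proof -
  have "(\<Sum>l'\<in>{1..m}. if nat_dist l l' = r then f l' else 0)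
      = (\<Sum>l'\<in>{1..m}. (if l' = l - r then (if r < l then f (l - r) else 0) else 0)
           + (if l' = l + r then f (l + r) else 0))"
    using assms by (intro sum.cong refl) (auto simp: nat_dist_def)
  also have "\<dots> = (if r < l then f (l - r) else 0) + (if l + r \<le> m then f (l + r) else 0)"
    unfolding sum.distrib using assms by (auto simp: sum.delta)
  finally show ?thesis .
qed

lemma jackson_corr_alt:
  assumes "r > 0"
  shows "jackson_corr n r = (\<Sum>l\<in>{1..n+1}. jackson_coeff n l *
    ((if r < l then jackson_coeff n (l - r) else 0)
      + (if l + r \<le> n + 1 then jackson_coeff n (l + r) else 0)))"
  unfolding jackson_corr_def
proof (intro sum.cong refl)
  fix l assume l: "l \<in> {1..n+1}"
  have "(\<Sum>l'\<in>{1..n+1}. if nat_dist l l' = r then jackson_coeff n l * jackson_coeff n l' else 0)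
      = jackson_coeff n l * (\<Sum>l'\<in>{1..n+1}. if nat_dist l l' = r then jackson_coeff n l' else 0)"
    unfolding sum_distrib_left by (intro sum.cong) auto
  then show "(\<Sum>l'\<in>{1..n+1}. if nat_dist l l' = r then jackson_coeff n l * jackson_coeff n l' else 0)
     = jackson_coeff n l * ((if r < l then jackson_coeff n (l - r) else 0)
      + (if l + r \<le> n + 1 then jackson_coeff n (l + r) else 0))"
    unfolding sum_nat_dist_eq[OF l assms] .
qed

lemma jackson_corr_0: "jackson_corr n 0 = jackson_mass n"
proof -
  have "nat_dist l l' = 0 \<longleftrightarrow> l = l'" for l l' by (auto simp: nat_dist_def)
  then show ?thesis
    by (simp add: jackson_corr_def jackson_mass_def power2_eq_square sum.delta' del: sum.cl_ivl_Suc)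
qed

text \<open>The sine vanishes at 0 and n + 2, so missing neighbours may be counted as well, and the
  addition theorem turns the sum of both neighbours into 2 cos h times the coefficient
  itself.\<close>

lemma jackson_corr_1: "jackson_corr n 1 = 2 * cos (pi / real (n + 2)) * jackson_mass n"
proof -
  define h where "h = pi / real (n + 2)"
  have hn: "real (n + 2) * h = pi" by (simp add: h_def)
  have a: "jackson_coeff n m = sin (real m * h)" for m by (simp add: jackson_coeff_def h_def)
  have "jackson_coeff n l *
    ((if 1 < l then jackson_coeff n (l - 1) else 0)
      + (if l + 1 \<le> n + 1 then jackson_coeff n (l + 1) else 0)) = 2 * cos h * (jackson_coeff n l)\<^sup>2"
    if l: "l \<in> {1..n+1}" for l
  proof -
    have 1: "(if 1 < l then jackson_coeff n (l - 1) else 0) = sin (real l * h - h)"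
      using l by (cases "l = 1") (auto simp: a of_nat_diff left_diff_distrib)
    have 2: "(if l + 1 \<le> n + 1 then jackson_coeff n (l + 1) else 0) = sin (real l * h + h)"
    proof (cases "l = n + 1")
      case True
      then have "real l * h + h = pi" using hn by (simp add: algebra_simps)
      then show ?thesis using True by simp
    qed (use l in \<open>auto simp: a distrib_right add.commute\<close>)
    show ?thesis unfolding 1 2 unfolding a
      by (simp add: sin_add sin_diff power2_eq_square)
  qed
  then show ?thesis
    unfolding jackson_corr_alt[OF zero_less_one] h_def[symmetric] jackson_mass_def sum_distrib_left
    by (intro sum.cong refl) auto
qed

text \<open>At lag 2 the sine formula may be read at the indices -1 and n + 3, where it equals - sin
  h \<le> 0 while the true coefficient is 0. Hence an inequality only, in the direction that the
  variance needs.\<close>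

lemma jackson_corr_2_ge: "jackson_corr n 2 \<ge> 2 * cos (2 * (pi / real (n + 2))) * jackson_mass n"
proof -
  define h where "h = pi / real (n + 2)"
  have hn: "real (n + 2) * h = pi" by (simp add: h_def)
  have a: "jackson_coeff n m = sin (real m * h)" for m by (simp add: jackson_coeff_def h_def)
  have h0: "h > 0" by (simp add: h_def)
  have "jackson_coeff n l *
    ((if 2 < l then jackson_coeff n (l - 2) else 0)
      + (if l + 2 \<le> n + 1 then jackson_coeff n (l + 2) else 0)) \<ge> 2 * cos (2 * h) * (jackson_coeff n l)\<^sup>2"
    if l: "l \<in> {1..n+1}" for l
  proof -
    have 1: "(if 2 < l then jackson_coeff n (l - 2) else 0) \<ge> sin (real l * h - 2 * h)"
    proof (cases "2 < l")
      case False
      then have "l = 1 \<or> l = 2" using l by auto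
      moreover have "sin h \<ge> 0"
        by (rule sin_ge_zero) (auto simp: h_def field_simps)
      ultimately show ?thesis by auto
    qed (auto simp: a of_nat_diff left_diff_distrib)
    have 2: "(if l + 2 \<le> n + 1 then jackson_coeff n (l + 2) else 0) \<ge> sin (real l * h + 2 * h)"
    proof (cases "l + 2 \<le> n + 1")
      case False
      then have "l = n \<or> l = n + 1" using l by auto
      then have "real l * h + 2 * h = pi \<or> real l * h + 2 * h = pi + h"
        using hn by (auto simp: algebra_simps)
      moreover have "sin h \<ge> 0"
        by (rule sin_ge_zero) (auto simp: h_def field_simps)
      ultimately have "sin (real l * h + 2 * h) \<le> 0" by (elim disjE) (simp_all only: sin_pi sin_add, simp_all)
      then show ?thesis using False by simp
    qed (auto simp: a distrib_right add.commute)
    have "2 * cos (2 * h) * (jackson_coeff n l)\<^sup>2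
        = jackson_coeff n l * (sin (real l * h - 2 * h) + sin (real l * h + 2 * h))"
      unfolding a
      by (simp add: sin_add sin_diff power2_eq_square)
    also have "\<dots> \<le> jackson_coeff n l *
    ((if 2 < l then jackson_coeff n (l - 2) else 0)
      + (if l + 2 \<le> n + 1 then jackson_coeff n (l + 2) else 0))"
      by (intro mult_left_mono add_mono 1 2 less_imp_le[OF jackson_coeff_pos[OF l]])
    finally show ?thesis .
  qed
  then show ?thesis
    unfolding jackson_corr_alt[OF zero_less_numeral] h_def[symmetric] jackson_mass_def sum_distrib_left
    by (intro sum_mono)
qed

lemma jackson_sum_eq_1:
  assumes "\<bar>x\<bar> \<le> 1"
  shows "(\<Sum>j<n+2. poly (jackson_poly n j) x) = 1"
proof -
  obtain t where x: "x = cos t" using assms by (metis abs_le_iff cos_arccos minus_le_iff)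
  show ?thesis
    unfolding x using jackson_moment[of 0 n t] jackson_mass_pos[of n]
    by (simp add: jackson_corr_0 del: sum.lessThan_Suc)
qed

lemma jackson_variance:
  assumes "\<bar>x\<bar> \<le> 1"
  shows "(\<Sum>j<n+2. poly (jackson_poly n j) x * (x - cheb_node (n + 2) j)\<^sup>2) \<le> 2 * (pi / real (n + 2))\<^sup>2"
proof -
  obtain t where x: "x = cos t" using assms by (metis abs_le_iff cos_arccos minus_le_iff)
  define h where "h = pi / real (n + 2)"
  define \<rho> where "\<rho> = jackson_corr n 2 / (2 * jackson_mass n)"
  let ?k = "\<lambda>j. poly (jackson_poly n j)" and ?b = "cheb_angle (n + 2)"
  have A: "jackson_mass n > 0" by (rule jackson_mass_pos)
  have m1: "(\<Sum>j<n+2. ?k j (cos t) * cos (?b j)) = cos h * cos t" for t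
    using jackson_moment[of 1 n t] A unfolding jackson_corr_1 h_def[symmetric]
    by (simp del: sum.lessThan_Suc)
  have m2: "(\<Sum>j<n+2. ?k j (cos t) * cos (2 * ?b j)) = \<rho> * cos (2 * t)" for t
    using jackson_moment[of 2 n t] A by (simp add: \<rho>_def del: sum.lessThan_Suc)
  \<comment> \<open>At t = 0 the second moment exhibits \<rho> as a weighted mean of cosines with
    nonnegative weights of sum 1.\<close>
  have \<rho>le: "\<rho> \<le> 1"
  proof -
    have "\<rho> = (\<Sum>j<n+2. ?k j (cos 0) * cos (2 * ?b j))" using m2[of 0] by (simp del: sum.lessThan_Suc)
    also have "\<dots> \<le> (\<Sum>j<n+2. ?k j (cos 0) * 1)"
      by (intro sum_mono mult_left_mono jackson_poly_nonneg) auto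
    also have "\<dots> = 1" using jackson_sum_eq_1[of 1 n] by (simp del: sum.lessThan_Suc)
    finally show ?thesis .
  qed
  have \<rho>ge: "\<rho> \<ge> cos (2 * h)"
    using jackson_corr_2_ge[of n] A by (simp add: \<rho>_def h_def field_simps)
  have cosb: "1 - cos y \<le> y\<^sup>2 / 2" for y :: real
  proof -
    have "1 - cos y = 2 * (sin (y / 2))\<^sup>2" using cos_double_sin[of "y / 2"] by simp
    also have "(sin (y / 2))\<^sup>2 \<le> (y / 2)\<^sup>2"
      using abs_sin_le_one abs_sin_x_le_abs_x[of "y / 2"] by (metis abs_le_square_iff)
    finally show ?thesis by (simp add: power_divide)
  qed
  have "(\<Sum>j<n+2. ?k j x * (x - cheb_node (n + 2) j)\<^sup>2)
     = (\<Sum>j<n+2. (x\<^sup>2 + 1 / 2) * ?k j (cos t) - 2 * x * (?k j (cos t) * cos (?b j))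
          + 1 / 2 * (?k j (cos t) * cos (2 * ?b j)))"
    by (intro sum.cong refl)
      (simp add: x cheb_node_def cos_double_cos power2_eq_square algebra_simps)
  also have "\<dots> = (x\<^sup>2 + 1 / 2) - 2 * x * (cos h * x) + 1 / 2 * (\<rho> * cos (2 * t))"
    unfolding sum.distrib sum_subtractf sum_distrib_left[symmetric] m1 m2
    using jackson_sum_eq_1[OF assms, of n] by (simp add: x del: sum.lessThan_Suc)
  also have "\<dots> = x\<^sup>2 * (1 - 2 * cos h + \<rho>) + (1 - \<rho>) / 2"
    unfolding cos_double_cos x[symmetric] by (simp add: power2_eq_square field_simps)
  also have "\<dots> \<le> 1 * h\<^sup>2 + h\<^sup>2"
  proof (rule add_mono)
    have "x\<^sup>2 * (1 - 2 * cos h + \<rho>) \<le> x\<^sup>2 * h\<^sup>2"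
      using cosb[of h] \<rho>le by (intro mult_left_mono) auto
    also have "\<dots> \<le> 1 * h\<^sup>2" using assms by (intro mult_right_mono) (auto simp: abs_square_le_1)
    finally show "x\<^sup>2 * (1 - 2 * cos h + \<rho>) \<le> 1 * h\<^sup>2" .
    show "(1 - \<rho>) / 2 \<le> h\<^sup>2" using cosb[of "2 * h"] \<rho>ge by (simp add: power_mult_distrib)
  qed
  finally show ?thesis by (simp add: h_def)
qed

section \<open>Tensor products on the cube\<close>

lemma finite_multi_idx: "finite (multi_idx k :: ('n::finite \<Rightarrow> nat) set)"
  and multi_idx_subset: "(multi_idx k :: ('n::finite \<Rightarrow> nat) set) \<subseteq> UNIV \<rightarrow>\<^sub>E {..k}"
proof -
  show *: "(multi_idx k :: ('n \<Rightarrow> nat) set) \<subseteq> UNIV \<rightarrow>\<^sub>E {..k}"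
  proof
    fix \<alpha> :: "'n \<Rightarrow> nat" assume "\<alpha> \<in> multi_idx k"
    then have "\<alpha> i \<le> k" for i
      unfolding multi_idx_def using member_le_sum[of i UNIV \<alpha>] by auto
    then show "\<alpha> \<in> UNIV \<rightarrow>\<^sub>E {..k}" by auto
  qed
  show "finite (multi_idx k :: ('n \<Rightarrow> nat) set)"
    by (rule finite_subset[OF *]) (simp add: finite_PiE)
qed

lemma sum_prod_UNIV:
  fixes f :: "'n::finite \<Rightarrow> 'b \<Rightarrow> real"
  assumes "finite B"
  shows "(\<Sum>j\<in>UNIV \<rightarrow>\<^sub>E B. \<Prod>i\<in>UNIV. f i (j i)) = (\<Prod>i\<in>UNIV. \<Sum>b\<in>B. f i b)"
  by (rule prod_sum_PiE[symmetric]) (use assms in auto)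

definition grid :: "nat \<Rightarrow> ('n::finite \<Rightarrow> nat) set" where
  "grid N = UNIV \<rightarrow>\<^sub>E {..<N}"

definition grid_point :: "real \<Rightarrow> nat \<Rightarrow> ('n::finite \<Rightarrow> nat) \<Rightarrow> real^'n" where
  "grid_point R N j = (\<chi> i. R * cheb_node N (j i))"

lemma finite_grid: "finite (grid N)"
  by (simp add: grid_def finite_PiE)

lemma grid_point_in_cube: "R \<ge> 0 \<Longrightarrow> grid_point R N j \<in> cube R"
  using abs_cheb_node_le_1 by (auto simp: cube_def grid_point_def abs_mult mult_left_le)

text \<open>Products of the one-dimensional weights, rescaled by R, are dual to the monomials on the
  grid: they return 1 on their own multi-index and 0 on every other one in
  \<open>multi_idx k\<close>. Any prescribed moments are thus attained by a linear
  combination.\<close>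

lemma exists_grid_weights:
  fixes m :: "('n::finite \<Rightarrow> nat) \<Rightarrow> real"
  assumes R: "R > 0" and b: "\<And>\<alpha>. \<alpha> \<in> multi_idx k \<Longrightarrow> \<bar>m \<alpha>\<bar> \<le> b"
  shows "\<exists>w. (\<forall>\<beta>\<in>multi_idx k. (\<Sum>j\<in>grid (Suc k). w j * mono_pow \<beta> (grid_point R (Suc k) j)) = m \<beta>)
    \<and> (\<Sum>j\<in>grid (Suc k). \<bar>w j\<bar>) \<le> b * (2 * real (Suc k) * exp (real k / R)) ^ CARD('n)"
proof -
  let ?N = "Suc k"
  define w where "w j = (\<Sum>\<alpha>\<in>multi_idx k. m \<alpha> * (\<Prod>i\<in>UNIV. coeff_weight k (\<alpha> i) (j i) / R ^ \<alpha> i))"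
    for j :: "'n \<Rightarrow> nat"
  have one: "(\<Sum>j<?N. coeff_weight k a j / R ^ a * (R * cheb_node ?N j) ^ l) = (if a = l then 1 else 0)"
    if "l \<le> k" for a l
  proof -
    have "(\<Sum>j<?N. coeff_weight k a j / R ^ a * (R * cheb_node ?N j) ^ l)
        = R ^ l / R ^ a * (\<Sum>j<?N. coeff_weight k a j * cheb_node ?N j ^ l)"
      unfolding sum_distrib_left by (intro sum.cong refl) (simp add: power_mult_distrib)
    then show ?thesis unfolding sum_coeff_weight_power[OF that] using R by auto
  qed
  have moments: "(\<Sum>j\<in>grid ?N. w j * mono_pow \<beta> (grid_point R ?N j)) = m \<beta>" if \<beta>: "\<beta> \<in> multi_idx k" for \<beta>
  proof -
    have "(\<Sum>j\<in>grid ?N. w j * mono_pow \<beta> (grid_point R ?N j))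
        = (\<Sum>\<alpha>\<in>multi_idx k. m \<alpha> * (\<Sum>j\<in>grid ?N. \<Prod>i\<in>UNIV.
            coeff_weight k (\<alpha> i) (j i) / R ^ \<alpha> i * (R * cheb_node ?N (j i)) ^ \<beta> i))"
      unfolding w_def sum_distrib_right sum_distrib_left
      by (subst sum.swap) (simp only: mono_pow_def grid_point_def prod.distrib vec_lambda_beta mult.assoc)
    also have "\<dots> = (\<Sum>\<alpha>\<in>multi_idx k. m \<alpha> * (\<Prod>i\<in>UNIV. if \<alpha> i = \<beta> i then 1 else 0))"
    proof (intro sum.cong refl arg_cong2[of _ _ _ _ "(*)"])
      fix \<alpha> :: "'n \<Rightarrow> nat"
      have "\<beta> i \<le> k" for i using \<beta> multi_idx_subset by blast
      then show "(\<Sum>j\<in>grid ?N. \<Prod>i\<in>UNIV. coeff_weight k (\<alpha> i) (j i) / R ^ \<alpha> i * (R * cheb_node ?N (j i)) ^ \<beta> i)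
        = (\<Prod>i\<in>UNIV. if \<alpha> i = \<beta> i then 1 else 0)"
        unfolding grid_def by (subst sum_prod_UNIV) (simp_all only: finite_lessThan one)
    qed
    also have "\<dots> = (\<Sum>\<alpha>\<in>multi_idx k. if \<alpha> = \<beta> then m \<beta> else 0)"
      by (intro sum.cong refl) (auto simp: fun_eq_iff intro: arg_cong[of _ _ m])
    also have "\<dots> = m \<beta>" using \<beta> by (simp add: finite_multi_idx)
    finally show ?thesis .
  qed
  have b0: "b \<ge> 0" using b[of "\<lambda>_. 0"] by (simp add: multi_idx_def)
  have "(\<Sum>j\<in>grid ?N. \<bar>w j\<bar>)
      \<le> (\<Sum>j\<in>grid ?N. \<Sum>\<alpha>\<in>multi_idx k. b * (\<Prod>i\<in>(UNIV :: 'n set). \<bar>coeff_weight k (\<alpha> i) (j i)\<bar> / R ^ \<alpha> i))"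
    unfolding w_def
  proof (rule sum_mono, rule order_trans[OF sum_abs], rule sum_mono)
    fix j \<alpha> :: "'n \<Rightarrow> nat" assume "\<alpha> \<in> multi_idx k"
    then show "\<bar>m \<alpha> * (\<Prod>i\<in>UNIV. coeff_weight k (\<alpha> i) (j i) / R ^ \<alpha> i)\<bar>
        \<le> b * (\<Prod>i\<in>UNIV. \<bar>coeff_weight k (\<alpha> i) (j i)\<bar> / R ^ \<alpha> i)"
      using R b[of \<alpha>] by (simp add: abs_mult abs_prod mult_right_mono prod_nonneg)
  qed
  also have "\<dots> = b * (\<Sum>\<alpha>\<in>multi_idx k. \<Sum>j\<in>grid ?N. \<Prod>i\<in>(UNIV :: 'n set). \<bar>coeff_weight k (\<alpha> i) (j i)\<bar> / R ^ \<alpha> i)"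
    unfolding sum_distrib_left by (rule sum.swap)
  \<comment> \<open>The simplex of multi-indices is enlarged to the full box, on which the sum
    factorises into a d-th power.\<close>
  also have "\<dots> \<le> b * (\<Sum>\<alpha>\<in>UNIV \<rightarrow>\<^sub>E {..k}. \<Sum>j\<in>grid ?N. \<Prod>i\<in>(UNIV :: 'n set). \<bar>coeff_weight k (\<alpha> i) (j i)\<bar> / R ^ \<alpha> i)"
    using R b0 multi_idx_subset
    by (intro mult_left_mono sum_mono2) (auto simp: finite_PiE intro!: sum_nonneg prod_nonneg)
  also have "(\<Sum>\<alpha>\<in>UNIV \<rightarrow>\<^sub>E {..k}. \<Sum>j\<in>grid ?N. \<Prod>i\<in>(UNIV :: 'n set). \<bar>coeff_weight k (\<alpha> i) (j i)\<bar> / R ^ \<alpha> i)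
     = (\<Sum>\<alpha>\<in>UNIV \<rightarrow>\<^sub>E {..k}. \<Prod>i\<in>(UNIV :: 'n set). \<Sum>j<?N. \<bar>coeff_weight k (\<alpha> i) j\<bar> / R ^ \<alpha> i)"
    unfolding grid_def by (subst sum_prod_UNIV) simp_all
  also have "\<dots> = (\<Sum>a\<le>k. \<Sum>j<?N. \<bar>coeff_weight k a j\<bar> / R ^ a) ^ CARD('n)"
    by (subst sum_prod_UNIV) (simp_all only: finite_atMost prod_constant)
  also have "\<dots> \<le> (2 * real (Suc k) * exp (real k / R)) ^ CARD('n)"
  proof (rule power_mono)
    have "(\<Sum>a\<le>k. \<Sum>j<?N. \<bar>coeff_weight k a j\<bar> / R ^ a)
        = (\<Sum>a\<le>k. (\<Sum>j<?N. \<bar>coeff_weight k a j\<bar>) * (1 / R) ^ a)"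
      by (intro sum.cong refl) (simp only: sum_divide_distrib power_one_over times_divide_eq_right mult_1_right)
    also have "\<dots> \<le> 2 * real (Suc k) * exp (real k * (1 / R))"
      by (rule sum_abs_coeff_weight_le) (use R in simp)
    finally show "(\<Sum>a\<le>k. \<Sum>j<?N. \<bar>coeff_weight k a j\<bar> / R ^ a) \<le> 2 * real (Suc k) * exp (real k / R)"
      by simp
    show "0 \<le> (\<Sum>a\<le>k. \<Sum>j<?N. \<bar>coeff_weight k a j\<bar> / R ^ a)"
      using R by (intro sum_nonneg) simp
  qed
  finally have "(\<Sum>j\<in>grid ?N. \<bar>w j\<bar>) \<le> b * (2 * real ?N * exp (real k / R)) ^ CARD('n)"
    using b0 by (simp add: mult_left_mono)
  with moments show ?thesis by blast
qed

section \<open>Positive polynomial approximation on the cube\<close>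

text \<open>The approximant averages the values of f at the tensor nodes with nonnegative weights of
  sum 1 that are polynomials in x. So it inherits the bound S, and its error is at most the mean
  distance from x to the nodes.\<close>

lemma jackson_cube:
  fixes f :: "real^'n::finite \<Rightarrow> real"
  assumes R: "R > 0" and k: "k \<ge> 1" and f: "1-lipschitz_on (cube R) f"
    and S: "\<And>x. x \<in> cube R \<Longrightarrow> \<bar>f x\<bar> \<le> S"
  obtains c where
    "\<And>x. x \<in> cube R \<Longrightarrow> \<bar>f x - (\<Sum>\<alpha>\<in>multi_idx k. c \<alpha> * mono_pow \<alpha> x)\<bar>
        \<le> sqrt (2 * real CARD('n)) * pi * real CARD('n) * R / real k"
    "\<And>x. x \<in> cube R \<Longrightarrow> \<bar>\<Sum>\<alpha>\<in>multi_idx k. c \<alpha> * mono_pow \<alpha> x\<bar> \<le> S"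
proof -
  let ?d = "CARD('n)"
  \<comment> \<open>Degree n in each of the d variables keeps the total degree within k. For k < d
    it is 0, and N = n + 2 is still positive.\<close>
  define n where "n = k div ?d"
  define N where "N = n + 2"
  define z :: "('n \<Rightarrow> nat) \<Rightarrow> real^'n" where "z = grid_point R N"
  define h where "h = pi / real N"
  define c where "c \<alpha> = (\<Sum>j\<in>grid N. f (z j) * (\<Prod>i\<in>UNIV. coeff (jackson_poly n (j i)) (\<alpha> i) / R ^ \<alpha> i))"
    for \<alpha> :: "'n \<Rightarrow> nat"
  define K where "K j x = (\<Prod>i\<in>UNIV. poly (jackson_poly n (j i)) (x $ i / R))"
    for j and x :: "real^'n"
  have sub: "(UNIV \<rightarrow>\<^sub>E {..n}) \<subseteq> (multi_idx k :: ('n \<Rightarrow> nat) set)"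
  proof
    fix \<alpha> :: "'n \<Rightarrow> nat" assume "\<alpha> \<in> UNIV \<rightarrow>\<^sub>E {..n}"
    then have "(\<Sum>i\<in>UNIV. \<alpha> i) \<le> (\<Sum>i\<in>(UNIV::'n set). n)" by (intro sum_mono) auto
    also have "\<dots> \<le> k" by (simp add: n_def)
    finally show "\<alpha> \<in> multi_idx k" by (simp add: multi_idx_def)
  qed
  have p: "(\<Sum>\<alpha>\<in>multi_idx k. c \<alpha> * mono_pow \<alpha> x) = (\<Sum>j\<in>grid N. f (z j) * K j x)" for x
  proof -
    have K: "K j x = (\<Sum>\<alpha>\<in>multi_idx k. (\<Prod>i\<in>UNIV. coeff (jackson_poly n (j i)) (\<alpha> i) / R ^ \<alpha> i) * mono_pow \<alpha> x)" for j
    proof -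
      have "poly (jackson_poly n l) y = (\<Sum>a\<le>n. coeff (jackson_poly n l) a * y ^ a)" for l y
        unfolding poly_altdef using degree_jackson_poly[of n l]
        by (intro sum.mono_neutral_left) (auto simp: coeff_eq_0)
      then have "K j x = (\<Sum>\<alpha>\<in>UNIV \<rightarrow>\<^sub>E {..n}. \<Prod>i\<in>UNIV. coeff (jackson_poly n (j i)) (\<alpha> i) * (x $ i / R) ^ \<alpha> i)"
        unfolding K_def by (subst sum_prod_UNIV) simp_all
      also have "\<dots> = (\<Sum>\<alpha>\<in>UNIV \<rightarrow>\<^sub>E {..n}. (\<Prod>i\<in>UNIV. coeff (jackson_poly n (j i)) (\<alpha> i) / R ^ \<alpha> i) * mono_pow \<alpha> x)"
        unfolding mono_pow_def prod.distrib[symmetric] by (simp add: power_divide)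
      also have "\<dots> = (\<Sum>\<alpha>\<in>multi_idx k. (\<Prod>i\<in>UNIV. coeff (jackson_poly n (j i)) (\<alpha> i) / R ^ \<alpha> i) * mono_pow \<alpha> x)"
      proof (rule sum.mono_neutral_left[OF finite_multi_idx sub], rule ballI)
        fix \<alpha> :: "'n \<Rightarrow> nat" assume "\<alpha> \<in> multi_idx k - (UNIV \<rightarrow>\<^sub>E {..n})"
        then have "\<exists>i. \<not> \<alpha> i \<le> n" by (auto simp: PiE_iff)
        then obtain i where "\<alpha> i > n" by (auto simp: not_le)
        then have "coeff (jackson_poly n (j i)) (\<alpha> i) = 0"
          using degree_jackson_poly[of n "j i"] by (intro coeff_eq_0) simp
        then show "(\<Prod>i\<in>UNIV. coeff (jackson_poly n (j i)) (\<alpha> i) / R ^ \<alpha> i) * mono_pow \<alpha> x = 0"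
          by (auto intro!: exI[of _ i])
      qed
      finally show ?thesis .
    qed
    show ?thesis
      unfolding K c_def sum_distrib_left sum_distrib_right by (subst sum.swap) (simp only: mult.assoc)
  qed
  have bd: "\<bar>x $ i / R\<bar> \<le> 1" if "x \<in> cube R" for x :: "real^'n" and i
    using that R by (simp add: cube_def)
  have K0: "K j x \<ge> 0" if "x \<in> cube R" for j x
    unfolding K_def using bd[OF that] by (intro prod_nonneg ballI jackson_poly_nonneg)
  have K1: "(\<Sum>j\<in>grid N. K j x) = 1" if "x \<in> cube R" for x
    unfolding K_def grid_def N_def
    by (subst sum_prod_UNIV) (simp_all only: finite_lessThan jackson_sum_eq_1[OF bd[OF that]] prod.neutral_const)
  have zc: "z j \<in> cube R" for j unfolding z_def using R by (intro grid_point_in_cube) simp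
  have var1: "(\<Sum>j\<in>grid N. K j x * (x $ i - z j $ i)\<^sup>2) \<le> R\<^sup>2 * (2 * h\<^sup>2)" if x: "x \<in> cube R" for x i
  proof -
    \<comment> \<open>The square is placed in the i-th factor only: in every other coordinate the
      weights sum to 1, which leaves a one-dimensional variance.\<close>
    let ?g = "\<lambda>l a. poly (jackson_poly n a) (x $ l / R) * (if l = i then (x $ i / R - cheb_node N a)\<^sup>2 else 1)"
    have "(\<Sum>j\<in>grid N. K j x * (x $ i - z j $ i)\<^sup>2) = (\<Sum>j\<in>grid N. R\<^sup>2 * (\<Prod>l\<in>UNIV. ?g l (j l)))"
    proof (intro sum.cong refl)
      fix j :: "'n \<Rightarrow> nat"
      have "(x $ i - z j $ i)\<^sup>2 = R\<^sup>2 * (x $ i / R - cheb_node N (j i))\<^sup>2"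
        unfolding power_mult_distrib[symmetric] using R by (simp add: z_def grid_point_def right_diff_distrib)
      then show "K j x * (x $ i - z j $ i)\<^sup>2 = R\<^sup>2 * (\<Prod>l\<in>UNIV. ?g l (j l))"
        unfolding K_def prod.distrib by simp
    qed
    also have "\<dots> = R\<^sup>2 * (\<Prod>l\<in>UNIV. \<Sum>a<N. ?g l a)"
      unfolding sum_distrib_left[symmetric] grid_def by (subst sum_prod_UNIV) simp_all
    also have "(\<Prod>l\<in>UNIV. \<Sum>a<N. ?g l a) = (\<Prod>l\<in>UNIV. if l = i then \<Sum>a<N. ?g i a else 1)"
    proof (intro prod.cong refl)
      fix l
      show "(\<Sum>a<N. ?g l a) = (if l = i then \<Sum>a<N. ?g i a else 1)"
        by (cases "l = i") (simp_all only: N_def mult_1_right if_False if_True refl jackson_sum_eq_1[OF bd[OF x]])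
    qed
    also have "\<dots> = (\<Sum>a<N. ?g i a)" by simp
    also have "R\<^sup>2 * \<dots> \<le> R\<^sup>2 * (2 * h\<^sup>2)"
      using jackson_variance[OF bd[OF x], of n i] by (intro mult_left_mono) (simp_all add: N_def h_def del: sum.lessThan_Suc)
    finally show ?thesis .
  qed
  have err: "\<bar>f x - (\<Sum>j\<in>grid N. f (z j) * K j x)\<bar> \<le> sqrt (2 * real ?d) * R * h" if x: "x \<in> cube R" for x
  proof -
    \<comment> \<open>\<delta>^2 is the bound for the mean squared distance, d coordinates with 2
      R^2 h^2 each. The inequality r \<le> r^2 / (2 \<delta>) + \<delta> / 2, balanced at this
      \<delta>, takes the place of Cauchy-Schwarz.\<close>
    define \<delta> where "\<delta> = sqrt (2 * real ?d) * R * h"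
    have \<delta>: "\<delta> > 0" using R by (simp add: \<delta>_def h_def N_def)
    have "f x - (\<Sum>j\<in>grid N. f (z j) * K j x) = (\<Sum>j\<in>grid N. (f x - f (z j)) * K j x)"
      unfolding left_diff_distrib sum_subtractf sum_distrib_left[symmetric] K1[OF x] by simp
    also have "\<bar>\<dots>\<bar> \<le> (\<Sum>j\<in>grid N. (dist x (z j))\<^sup>2 / (2 * \<delta>) * K j x + \<delta> / 2 * K j x)"
    proof (intro order_trans[OF sum_abs] sum_mono)
      fix j
      have "\<bar>f x - f (z j)\<bar> \<le> dist x (z j)"
        using lipschitz_onD[OF f x zc[of j]] by (simp add: dist_real_def)
      also have "\<dots> \<le> (dist x (z j))\<^sup>2 / (2 * \<delta>) + \<delta> / 2"
        using sum_squares_ge_zero[of "dist x (z j) - \<delta>" 0] \<delta> by (simp add: field_simps power2_eq_square)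
      finally have "\<bar>f x - f (z j)\<bar> * K j x \<le> ((dist x (z j))\<^sup>2 / (2 * \<delta>) + \<delta> / 2) * K j x"
        by (rule mult_right_mono[OF _ K0[OF x]])
      then show "\<bar>(f x - f (z j)) * K j x\<bar> \<le> (dist x (z j))\<^sup>2 / (2 * \<delta>) * K j x + \<delta> / 2 * K j x"
        using K0[OF x, of j] by (simp add: abs_mult distrib_right)
    qed
    also have "\<dots> = (\<Sum>i\<in>UNIV. \<Sum>j\<in>grid N. K j x * (x $ i - z j $ i)\<^sup>2) / (2 * \<delta>) + \<delta> / 2"
    proof -
      have "(dist x (z j))\<^sup>2 = (\<Sum>i\<in>UNIV. (x $ i - z j $ i)\<^sup>2)" for j
        by (simp add: dist_norm norm_vec_def L2_set_def sum_nonneg)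
      then have "(\<Sum>j\<in>grid N. (dist x (z j))\<^sup>2 / (2 * \<delta>) * K j x)
          = (\<Sum>i\<in>UNIV. \<Sum>j\<in>grid N. K j x * (x $ i - z j $ i)\<^sup>2) / (2 * \<delta>)"
        by (subst sum.swap) (simp add: sum_distrib_left sum_divide_distrib mult_ac)
      then show ?thesis unfolding sum.distrib sum_distrib_left[symmetric] K1[OF x] by simp
    qed
    also have "\<dots> \<le> (\<Sum>i\<in>(UNIV::'n set). R\<^sup>2 * (2 * h\<^sup>2)) / (2 * \<delta>) + \<delta> / 2"
      using \<delta> by (intro add_right_mono divide_right_mono sum_mono var1[OF x]) simp
    also have "(\<Sum>i\<in>(UNIV::'n set). R\<^sup>2 * (2 * h\<^sup>2)) = \<delta>\<^sup>2"
      by (simp add: \<delta>_def power_mult_distrib)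
    also have "\<delta>\<^sup>2 / (2 * \<delta>) + \<delta> / 2 = \<delta>" using \<delta> by (simp add: power2_eq_square)
    finally show ?thesis by (simp add: \<delta>_def)
  qed
  \<comment> \<open>Splitting the degree among d coordinates costs the factor d in the constant; k <
    d (n + 1) is more than enough for k \<le> d N.\<close>
  have hk: "h \<le> pi * real ?d / real k"
  proof -
    have "k < ?d * (n + 1)"
      using dividend_less_div_times[of ?d k] by (simp add: n_def mult.commute)
    then have "k \<le> ?d * N" unfolding N_def by (simp add: algebra_simps)
    then have "real k \<le> real ?d * real N" by (metis of_nat_le_iff of_nat_mult)
    then have "pi * real k \<le> pi * (real ?d * real N)" by (intro mult_left_mono) auto
    moreover have "real N > 0" by (simp add: N_def)
    ultimately show ?thesis using k unfolding h_def by (simp add: field_simps)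
  qed
  show thesis
  proof (rule that[of c])
    fix x :: "real^'n" assume x: "x \<in> cube R"
    have "sqrt (2 * real ?d) * R * h \<le> sqrt (2 * real ?d) * R * (pi * real ?d / real k)"
      using R by (intro mult_left_mono hk) simp
    then show "\<bar>f x - (\<Sum>\<alpha>\<in>multi_idx k. c \<alpha> * mono_pow \<alpha> x)\<bar> \<le> sqrt (2 * real ?d) * pi * real ?d * R / real k"
      unfolding p using err[OF x] by (simp add: mult_ac)
    have "\<bar>\<Sum>j\<in>grid N. f (z j) * K j x\<bar> \<le> (\<Sum>j\<in>grid N. S * K j x)"
      using S[OF zc] K0[OF x] by (intro order_trans[OF sum_abs] sum_mono) (simp add: abs_mult mult_right_mono)
    then show "\<bar>\<Sum>\<alpha>\<in>multi_idx k. c \<alpha> * mono_pow \<alpha> x\<bar> \<le> S"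
      unfolding p sum_distrib_left[symmetric] K1[OF x] by simp
  qed
qed

section \<open>The nilpotent matrix and its exponential\<close>

definition idx_size :: "('n::finite \<Rightarrow> nat) \<Rightarrow> nat" where
  "idx_size \<alpha> = (\<Sum>i\<in>UNIV. \<alpha> i)"

lemma mem_multi_idx: "\<alpha> \<in> multi_idx k \<longleftrightarrow> idx_size \<alpha> \<le> k"
  by (simp add: multi_idx_def idx_size_def)

lemma idx_size_lower: "2 \<le> \<alpha> i \<Longrightarrow> idx_size (\<alpha>(i := \<alpha> i - 2)) + 2 = idx_size (\<alpha> :: 'n::finite \<Rightarrow> nat)"
  unfolding idx_size_def
  by (simp add: sum.remove[of UNIV i])

text \<open>Lowering an exponent by 2 stays inside \<open>multi_idx k\<close>, so the truncation of
  the matrix loses no entry of a row.\<close>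

lemma A_apply_eq:
  fixes v :: "('n::finite \<Rightarrow> nat) \<Rightarrow> real"
  assumes \<alpha>: "\<alpha> \<in> multi_idx k"
  shows "A_apply k v \<alpha> = (\<Sum>i\<in>UNIV. if 2 \<le> \<alpha> i then real (\<alpha> i * (\<alpha> i - 1)) * v (\<alpha>(i := \<alpha> i - 2)) else 0)"
proof -
  have "A_apply k v \<alpha> = (\<Sum>i\<in>UNIV. \<Sum>\<alpha>'\<in>multi_idx k.
      (if 2 \<le> \<alpha> i \<and> \<alpha>' = \<alpha>(i := \<alpha> i - 2) then real (\<alpha> i * (\<alpha> i - 1)) else 0) * v \<alpha>')"
    unfolding A_apply_def A_entry_def sum_distrib_right by (rule sum.swap)
  also have "\<dots> = (\<Sum>i\<in>UNIV. if 2 \<le> \<alpha> i then real (\<alpha> i * (\<alpha> i - 1)) * v (\<alpha>(i := \<alpha> i - 2)) else 0)"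
  proof (intro sum.cong refl)
    fix i
    show "(\<Sum>\<alpha>'\<in>multi_idx k. (if 2 \<le> \<alpha> i \<and> \<alpha>' = \<alpha>(i := \<alpha> i - 2) then real (\<alpha> i * (\<alpha> i - 1)) else 0) * v \<alpha>')
       = (if 2 \<le> \<alpha> i then real (\<alpha> i * (\<alpha> i - 1)) * v (\<alpha>(i := \<alpha> i - 2)) else 0)"
    proof (cases "2 \<le> \<alpha> i")
      case True
      then have "\<alpha>(i := \<alpha> i - 2) \<in> multi_idx k"
        using \<alpha> idx_size_lower[of \<alpha> i] by (simp add: mem_multi_idx)
      then have "(\<Sum>\<alpha>'\<in>multi_idx k. if \<alpha>' = \<alpha>(i := \<alpha> i - 2) then real (\<alpha> i * (\<alpha> i - 1)) * v \<alpha>' else 0)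
         = real (\<alpha> i * (\<alpha> i - 1)) * v (\<alpha>(i := \<alpha> i - 2))"
        by (simp add: finite_multi_idx)
      then show ?thesis using True by (simp add: if_distrib[of "\<lambda>x. x * _"] cong: if_cong)
    qed simp
  qed
  finally show ?thesis .
qed

text \<open>The row sum of the matrix at \<open>\<alpha>\<close> is \<open>\<Sum>i. \<alpha>\<^sub>i (\<alpha>\<^sub>i - 1) \<le> |\<alpha>| (|\<alpha>| - 1)\<close>, so iterating
  gives the falling factorial of length \<open>2j\<close>.\<close>

lemma A_iter_bound:
  fixes v :: "('n::finite \<Rightarrow> nat) \<Rightarrow> real"
  assumes b: "\<And>\<beta>. \<beta> \<in> multi_idx k \<Longrightarrow> \<bar>v \<beta>\<bar> \<le> b" and \<alpha>: "\<alpha> \<in> multi_idx k"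
  shows "\<bar>(A_apply k ^^ j) v \<alpha>\<bar>
    \<le> (if 2 * j \<le> idx_size \<alpha> then fact (idx_size \<alpha>) / fact (idx_size \<alpha> - 2 * j) else 0) * b"
  using \<alpha>
proof (induction j arbitrary: \<alpha>)
  case 0
  then show ?case using b by simp
next
  case (Suc j)
  define a where "a = idx_size \<alpha>"
  have b0: "b \<ge> 0" using b[OF Suc.prems] by linarith
  define B where "B = (if 2 * Suc j \<le> a then fact (a - 2) / fact (a - 2 * Suc j) else 0 :: real)"
  have B0: "B \<ge> 0" by (simp add: B_def)
  have "\<bar>(A_apply k ^^ Suc j) v \<alpha>\<bar>
      \<le> (\<Sum>i\<in>UNIV. \<bar>if 2 \<le> \<alpha> i then real (\<alpha> i * (\<alpha> i - 1)) * (A_apply k ^^ j) v (\<alpha>(i := \<alpha> i - 2)) else 0\<bar>)"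
    by (simp only: funpow.simps o_def A_apply_eq[OF Suc.prems] sum_abs)
  also have "\<dots> \<le> (\<Sum>i\<in>UNIV. real (\<alpha> i) * (real (a - 1) * (B * b)))"
  proof (rule sum_mono)
    fix i
    show "\<bar>if 2 \<le> \<alpha> i then real (\<alpha> i * (\<alpha> i - 1)) * (A_apply k ^^ j) v (\<alpha>(i := \<alpha> i - 2)) else 0\<bar>
       \<le> real (\<alpha> i) * (real (a - 1) * (B * b))"
    proof (cases "2 \<le> \<alpha> i")
      case True
      define \<beta> where "\<beta> = \<alpha>(i := \<alpha> i - 2)"
      have s: "idx_size \<beta> = a - 2" and a2: "a \<ge> 2"
        using idx_size_lower[of \<alpha> i] True by (auto simp: a_def \<beta>_def)
      have "\<beta> \<in> multi_idx k" using s Suc.prems by (simp add: mem_multi_idx a_def)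
      have e: "2 * j \<le> a - 2 \<longleftrightarrow> 2 * Suc j \<le> a" "a - 2 - 2 * j = a - 2 * Suc j"
        using a2 by auto
      from Suc.IH[OF \<open>\<beta> \<in> multi_idx k\<close>] have "\<bar>(A_apply k ^^ j) v \<beta>\<bar> \<le> B * b"
        unfolding s B_def e .
      moreover have "\<alpha> i \<le> a" unfolding a_def idx_size_def by (intro member_le_sum) auto
      ultimately have "real (\<alpha> i - 1) * \<bar>(A_apply k ^^ j) v \<beta>\<bar> \<le> real (a - 1) * (B * b)"
        by (intro mult_mono) auto
      then have "real (\<alpha> i) * (real (\<alpha> i - 1) * \<bar>(A_apply k ^^ j) v \<beta>\<bar>) \<le> real (\<alpha> i) * (real (a - 1) * (B * b))"
        by (intro mult_left_mono) auto
      then show ?thesis using True by (simp add: abs_mult mult.assoc \<beta>_def[symmetric])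
    qed (simp add: B0 b0)
  qed
  also have "\<dots> = real a * real (a - 1) * B * b"
    by (simp only: sum_distrib_right[symmetric] of_nat_sum[symmetric] idx_size_def[symmetric] a_def[symmetric] mult.assoc)
  also have "real a * real (a - 1) * B = (if 2 * Suc j \<le> a then fact a / fact (a - 2 * Suc j) else 0)"
  proof (cases "2 * Suc j \<le> a")
    case True
    then have "fact a = real a * real (a - 1) * fact (a - 2)"
      by (cases a; cases "a - 1") (auto simp: numeral_2_eq_2 algebra_simps)
    then show ?thesis using True by (simp add: B_def)
  qed (simp add: B_def)
  finally show ?case unfolding a_def .
qed

text \<open>Nilpotency is read off from the growth bound, whose right-hand side is 0 once 2 j
  exceeds the order of \<alpha>; the finite maximum of |v| serves as the bound on v.\<close>

lemma A_iter_eq_0: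
  fixes v :: "('n::finite \<Rightarrow> nat) \<Rightarrow> real"
  assumes "\<alpha> \<in> multi_idx k" "idx_size \<alpha> < 2 * j"
  shows "(A_apply k ^^ j) v \<alpha> = 0"
proof -
  have "\<bar>v \<beta>\<bar> \<le> Max ((\<lambda>\<beta>. \<bar>v \<beta>\<bar>) ` multi_idx k)" if "\<beta> \<in> multi_idx k" for \<beta>
    using that by (intro Max_ge) (auto simp: finite_multi_idx)
  from A_iter_bound[OF this assms(1), where j = j] show ?thesis using assms(2) by simp
qed

text \<open>The exponential series stops at j = k div 2, which is the origin of the power of T in
  the final estimate.\<close>

lemma expmA_finite:
  fixes v :: "('n::finite \<Rightarrow> nat) \<Rightarrow> real"
  assumes "\<alpha> \<in> multi_idx k"
  shows "expmA k T v \<alpha> = (\<Sum>j\<le>k div 2. ((- T) ^ j / fact j) * (A_apply k ^^ j) v \<alpha>)"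
  unfolding expmA_def
proof (rule suminf_finite)
  fix j assume "j \<notin> {..k div 2}"
  then have "idx_size \<alpha> < 2 * j" using assms by (auto simp: mem_multi_idx)
  from A_iter_eq_0[OF assms this] show "((- T) ^ j / fact j) * (A_apply k ^^ j) v \<alpha> = 0" by simp
qed simp

text \<open>The coefficients do not depend on v: each entry is a fixed finite linear form, and can
  therefore be exchanged with integrals of v.\<close>

lemma A_iter_linear:
  fixes \<alpha> :: "'n::finite \<Rightarrow> nat"
  assumes "\<alpha> \<in> multi_idx k"
  shows "\<exists>a. \<forall>v. (A_apply k ^^ j) v \<alpha> = (\<Sum>\<beta>\<in>multi_idx k. a \<beta> * v \<beta>)"
  using assms
proof (induction j arbitrary: \<alpha>)
  case 0
  have "(A_apply k ^^ 0) v \<alpha> = (\<Sum>\<beta>\<in>multi_idx k. (if \<beta> = \<alpha> then 1 else 0) * v \<beta>)" for v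
  proof -
    have "(\<Sum>\<beta>\<in>multi_idx k. (if \<beta> = \<alpha> then 1 else 0) * v \<beta>) = (\<Sum>\<beta>\<in>multi_idx k. if \<beta> = \<alpha> then v \<alpha> else 0)"
      by (intro sum.cong) auto
    then show ?thesis using 0 by (simp add: finite_multi_idx)
  qed
  then show ?case by (intro exI[of _ "\<lambda>\<beta>. if \<beta> = \<alpha> then 1 else 0"] allI)
next
  case (Suc j)
  have "\<forall>\<gamma>\<in>(multi_idx k :: ('n \<Rightarrow> nat) set). \<exists>a. \<forall>v. (A_apply k ^^ j) v \<gamma> = (\<Sum>\<beta>\<in>multi_idx k. a \<beta> * v \<beta>)"
    by (intro ballI Suc.IH)
  from bchoice[OF this] obtain a where
    "\<forall>\<gamma>\<in>(multi_idx k :: ('n \<Rightarrow> nat) set). \<forall>v. (A_apply k ^^ j) v \<gamma> = (\<Sum>\<beta>\<in>multi_idx k. a \<gamma> \<beta> * v \<beta>)" ..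
  then have a: "(A_apply k ^^ j) v \<gamma> = (\<Sum>\<beta>\<in>multi_idx k. a \<gamma> \<beta> * v \<beta>)" if "\<gamma> \<in> multi_idx k" for \<gamma> v
    using that by simp
  have "(A_apply k ^^ Suc j) v \<alpha> = (\<Sum>\<beta>\<in>multi_idx k. (\<Sum>\<gamma>\<in>multi_idx k. A_entry \<alpha> \<gamma> * a \<gamma> \<beta>) * v \<beta>)" for v
  proof -
    have "(A_apply k ^^ Suc j) v \<alpha> = (\<Sum>\<gamma>\<in>multi_idx k. A_entry \<alpha> \<gamma> * (\<Sum>\<beta>\<in>multi_idx k. a \<gamma> \<beta> * v \<beta>))"
      by (simp add: A_apply_def a)
    also have "\<dots> = (\<Sum>\<beta>\<in>multi_idx k. (\<Sum>\<gamma>\<in>multi_idx k. A_entry \<alpha> \<gamma> * a \<gamma> \<beta>) * v \<beta>)"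
      unfolding sum_distrib_left sum_distrib_right by (subst sum.swap) (simp add: mult.assoc)
    finally show ?thesis .
  qed
  then show ?case by (intro exI[of _ "\<lambda>\<beta>. \<Sum>\<gamma>\<in>multi_idx k. A_entry \<alpha> \<gamma> * a \<gamma> \<beta>"] allI)
qed

lemma expmA_linear:
  fixes \<alpha> :: "'n::finite \<Rightarrow> nat"
  assumes "\<alpha> \<in> multi_idx k"
  obtains a where "\<And>v. expmA k T v \<alpha> = (\<Sum>\<beta>\<in>multi_idx k. a \<beta> * v \<beta>)"
proof -
  have "\<forall>j. \<exists>a. \<forall>v. (A_apply k ^^ j) v \<alpha> = (\<Sum>\<beta>\<in>multi_idx k. a \<beta> * v \<beta>)"
    by (intro allI A_iter_linear[OF assms])
  from choice[OF this] obtain a where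
    "\<forall>j v. (A_apply k ^^ j) v \<alpha> = (\<Sum>\<beta>\<in>multi_idx k. a j \<beta> * v \<beta>)" ..
  then have a: "(A_apply k ^^ j) v \<alpha> = (\<Sum>\<beta>\<in>multi_idx k. a j \<beta> * v \<beta>)" for j v by simp
  have "expmA k T v \<alpha> = (\<Sum>\<beta>\<in>multi_idx k. (\<Sum>j\<le>k div 2. (- T) ^ j / fact j * a j \<beta>) * v \<beta>)" for v
    unfolding expmA_finite[OF assms] a sum_distrib_left sum_distrib_right
    by (subst sum.swap) (simp add: mult.assoc)
  then show thesis by (rule that)
qed

text \<open>Each of the j factors j + 1, ..., 2 j is at most 2 j. With 2 j \<le> k this bounds (2
  j)! / j! by k^j, the source of sqrt(k)^k.\<close>

lemma fact_double_le: "fact (2 * j) \<le> (2 * real j) ^ j * fact j"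
proof -
  have "(fact (2 * j) :: nat) = fact j * \<Prod>{Suc j..2 * j}"
    by (rule fact_eq_fact_times) simp
  also have "\<Prod>{Suc j..2 * j} \<le> (\<Prod>i\<in>{Suc j..2 * j}. 2 * j)"
    by (rule prod_mono) auto
  also have "\<dots> = (2 * j) ^ j" by simp
  finally have "fact (2 * j) \<le> (2 * j) ^ j * (fact j :: nat)" by (simp add: mult.commute)
  then have "real (fact (2 * j)) \<le> real ((2 * j) ^ j * fact j)" by (rule of_nat_mono)
  then show ?thesis by simp
qed

text \<open>The j-th coefficient a! / ((a - 2 j)! j!) equals the binomial of a over 2 j times (2 j)!
  / j!. The second factor is at most sqrt(k)^k, and the binomials of even index sum to at most
  2^k.\<close>

lemma expmA_bound:
  fixes v :: "('n::finite \<Rightarrow> nat) \<Rightarrow> real"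
  assumes b: "\<And>\<beta>. \<beta> \<in> multi_idx k \<Longrightarrow> \<bar>v \<beta>\<bar> \<le> b" and \<alpha>: "\<alpha> \<in> multi_idx k"
    and T: "T \<ge> 0" and k: "k \<ge> 1"
  shows "\<bar>expmA k T v \<alpha>\<bar> \<le> 2 ^ k * sqrt (real k) ^ k * max (T ^ (k div 2)) 1 * b"
proof -
  define a where "a = idx_size \<alpha>"
  define M where "M = max (T ^ (k div 2)) 1"
  have ak: "a \<le> k" using \<alpha> by (simp add: a_def mem_multi_idx)
  have b0: "b \<ge> 0" using b[OF \<alpha>] by linarith
  have summand: "\<bar>((- T) ^ j / fact j) * (A_apply k ^^ j) v \<alpha>\<bar> \<le> real (k choose (2 * j)) * (sqrt (real k) ^ k * M * b)"
    if j: "j \<le> k div 2" for j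
  proof (cases "2 * j \<le> a")
    case True
    have "T ^ j \<le> M"
    proof (cases "T \<le> 1")
      case True
      then show ?thesis using T power_le_one[of T j] by (simp add: M_def)
    next
      case False
      then have "T ^ j \<le> T ^ (k div 2)" using j by (intro power_increasing) auto
      then show ?thesis by (simp add: M_def)
    qed
    moreover have "fact a / fact (a - 2 * j) / fact j \<le> real (k choose (2 * j)) * sqrt (real k) ^ k"
    proof -
      have "fact a / fact (a - 2 * j) / fact j = real (a choose (2 * j)) * (fact (2 * j) / fact j)"
        unfolding binomial_fact[OF True] by simp
      also have "\<dots> \<le> real (k choose (2 * j)) * sqrt (real k) ^ k"
      proof (rule mult_mono)
        show "real (a choose (2 * j)) \<le> real (k choose (2 * j))"
          using ak by (simp add: binomial_right_mono)
        have "fact (2 * j) / fact j \<le> (2 * real j) ^ j"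
          using fact_double_le[of j] by (simp add: divide_le_eq)
        also have "\<dots> \<le> real k ^ j" using True ak by (intro power_mono) auto
        also have "\<dots> = sqrt (real k) ^ (2 * j)" by (simp add: power_mult)
        also have "\<dots> \<le> sqrt (real k) ^ k" using True ak k by (intro power_increasing) auto
        finally show "fact (2 * j) / fact j \<le> sqrt (real k) ^ k" .
      qed auto
      finally show ?thesis .
    qed
    ultimately have *: "T ^ j * (fact a / fact (a - 2 * j) / fact j) * b \<le> M * (real (k choose (2 * j)) * sqrt (real k) ^ k) * b"
      using b0 by (intro mult_right_mono mult_mono) (auto simp: M_def)
    have "\<bar>((- T) ^ j / fact j) * (A_apply k ^^ j) v \<alpha>\<bar> = T ^ j / fact j * \<bar>(A_apply k ^^ j) v \<alpha>\<bar>"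
      using T by (simp add: abs_mult power_abs)
    also have "\<dots> \<le> T ^ j / fact j * (fact a / fact (a - 2 * j) * b)"
      using A_iter_bound[OF b \<alpha>, where j = j] True T by (intro mult_left_mono) (auto simp: a_def)
    also have "\<dots> = T ^ j * (fact a / fact (a - 2 * j) / fact j) * b" by (simp add: mult_ac)
    finally show ?thesis using * by (simp add: mult_ac)
  next
    case False
    then have "(A_apply k ^^ j) v \<alpha> = 0" by (intro A_iter_eq_0[OF \<alpha>]) (simp add: a_def)
    then show ?thesis using b0 by (simp add: M_def)
  qed
  have "\<bar>expmA k T v \<alpha>\<bar> \<le> (\<Sum>j\<le>k div 2. real (k choose (2 * j)) * (sqrt (real k) ^ k * M * b))"
    unfolding expmA_finite[OF \<alpha>] by (intro order_trans[OF sum_abs] sum_mono summand) simp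
  also have "\<dots> = (\<Sum>j\<le>k div 2. real (k choose (2 * j))) * (sqrt (real k) ^ k * M * b)"
    by (simp add: sum_distrib_right)
  also have "(\<Sum>j\<le>k div 2. real (k choose (2 * j))) \<le> 2 ^ k"
  proof -
    have "(\<Sum>j\<le>k div 2. (k choose (2 * j))) = (\<Sum>j\<in>(\<lambda>j. 2 * j) ` {..k div 2}. (k choose j))"
      by (subst sum.reindex) (auto simp: inj_on_def)
    also have "\<dots> \<le> (\<Sum>j\<le>k. (k choose j))" by (intro sum_mono2) auto
    also have "\<dots> = 2 ^ k" by (rule choose_row_sum)
    finally show ?thesis by (metis of_nat_le_iff of_nat_numeral of_nat_power of_nat_sum)
  qed
  finally show ?thesis using b0 by (simp add: M_def mult_right_mono mult.assoc)
qed

section \<open>Heat polynomials and Gaussian moments\<close>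

text \<open>The heat polynomial, a Hermite polynomial of imaginary argument up to scaling: the
  caloric polynomial in (t, z) with initial value z^n, and for t > 0 the n-th moment of the normal
  law with mean z and variance 2 t.\<close>

definition heat_poly1 :: "real \<Rightarrow> nat \<Rightarrow> real \<Rightarrow> real" where
  "heat_poly1 t n z = (\<Sum>j\<le>n div 2. fact n / (fact (n - 2 * j) * fact j) * t ^ j * z ^ (n - 2 * j))"

definition heat_poly :: "real \<Rightarrow> real^'n::finite \<Rightarrow> ('n \<Rightarrow> nat) \<Rightarrow> real" where
  "heat_poly t z \<alpha> = (\<Prod>i\<in>UNIV. heat_poly1 t (\<alpha> i) (z $ i))"

lemma heat_poly1_at_0: "heat_poly1 0 n z = z ^ n"
proof -
  have "heat_poly1 0 n z = (\<Sum>j\<le>n div 2. if j = 0 then z ^ n else 0)"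
    unfolding heat_poly1_def by (intro sum.cong) (auto simp: power_0_left)
  then show ?thesis by simp
qed

lemma DERIV_heat_poly1:
  "((\<lambda>t. heat_poly1 t n z) has_real_derivative
     (if 2 \<le> n then real (n * (n - 1)) * heat_poly1 t (n - 2) z else 0)) (at t)"
proof (cases "2 \<le> n")
  case False
  then have "n div 2 = 0" by simp
  then show ?thesis using False by (simp add: heat_poly1_def)
next
  case True
  then obtain m where n: "n = Suc (Suc m)" by (metis add_2_eq_Suc le_Suc_ex)
  have "((\<lambda>t. heat_poly1 t n z) has_real_derivative
      (\<Sum>j\<le>Suc (m div 2). fact n / (fact (n - 2 * j) * fact j) * (real j * t ^ (j - 1)) * z ^ (n - 2 * j))) (at t)"
  proof -
    have "n div 2 = Suc (m div 2)" by (simp add: n)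
    show ?thesis
      unfolding heat_poly1_def \<open>n div 2 = _\<close>
      by (intro DERIV_sum) (rule derivative_eq_intros refl | simp)+
  qed
  also have "(\<Sum>j\<le>Suc (m div 2). fact n / (fact (n - 2 * j) * fact j) * (real j * t ^ (j - 1)) * z ^ (n - 2 * j))
      = real (n * (n - 1)) * heat_poly1 t (n - 2) z"
  proof -
    have "fact n / (fact (n - 2 * Suc j) * fact (Suc j)) * (real (Suc j) * t ^ (Suc j - 1)) * z ^ (n - 2 * Suc j)
        = real (n * (n - 1)) * (fact (n - 2) / (fact (n - 2 - 2 * j) * fact j) * t ^ j * z ^ (n - 2 - 2 * j))" for j
    proof -
      have gen: "x * f / (g * (s * h)) * (s * u) * w = x * (f / (g * h) * u * w)" if "s \<noteq> 0" for x f g s h u w :: real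
        using that by simp
      have 1: "(fact n :: real) = real (n * (n - 1)) * fact (n - 2)" by (simp add: n algebra_simps)
      have 2: "n - 2 * Suc j = n - 2 - 2 * j" by simp
      show ?thesis unfolding 1 2 fact_Suc[of j] diff_Suc_1 by (rule gen) simp
    qed
    note step = this
    have "(n - 2) div 2 = m div 2" by (simp add: n)
    then show ?thesis
      unfolding sum.atMost_Suc_shift heat_poly1_def sum_distrib_left step by simp
  qed
  finally show ?thesis using True by simp
qed

text \<open>The product rule differentiates one factor at a time, and each time derivative lowers
  one exponent by 2 with factor \<alpha>_i (\<alpha>_i - 1): this is row \<alpha> of the
  matrix.\<close>

lemma DERIV_heat_poly:
  fixes \<alpha> :: "'n::finite \<Rightarrow> nat"
  assumes \<alpha>: "\<alpha> \<in> multi_idx k"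
  shows "((\<lambda>t. heat_poly t z \<alpha>) has_real_derivative A_apply k (heat_poly t z) \<alpha>) (at t)"
proof -
  have "((\<lambda>t. heat_poly t z \<alpha>) has_real_derivative
     (\<Sum>i\<in>UNIV. (if 2 \<le> \<alpha> i then real (\<alpha> i * (\<alpha> i - 1)) * heat_poly1 t (\<alpha> i - 2) (z $ i) else 0)
        * (\<Prod>l\<in>UNIV - {i}. heat_poly1 t (\<alpha> l) (z $ l)))) (at t)"
    unfolding heat_poly_def by (intro has_field_derivative_prod DERIV_heat_poly1)
  also have "(\<Sum>i\<in>UNIV. (if 2 \<le> \<alpha> i then real (\<alpha> i * (\<alpha> i - 1)) * heat_poly1 t (\<alpha> i - 2) (z $ i) else 0)
        * (\<Prod>l\<in>UNIV - {i}. heat_poly1 t (\<alpha> l) (z $ l))) = A_apply k (heat_poly t z) \<alpha>"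
    unfolding A_apply_eq[OF \<alpha>]
  proof (intro sum.cong refl)
    fix i
    have "heat_poly t z (\<alpha>(i := \<alpha> i - 2))
        = heat_poly1 t (\<alpha> i - 2) (z $ i) * (\<Prod>l\<in>UNIV - {i}. heat_poly1 t (\<alpha> l) (z $ l))"
      unfolding heat_poly_def by (simp add: prod.remove[of UNIV i])
    then show "(if 2 \<le> \<alpha> i then real (\<alpha> i * (\<alpha> i - 1)) * heat_poly1 t (\<alpha> i - 2) (z $ i) else 0)
        * (\<Prod>l\<in>UNIV - {i}. heat_poly1 t (\<alpha> l) (z $ l))
      = (if 2 \<le> \<alpha> i then real (\<alpha> i * (\<alpha> i - 1)) * heat_poly t z (\<alpha>(i := \<alpha> i - 2)) else 0)"
      by simp
  qed
  finally show ?thesis .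
qed

lemma DERIV_A_iter_heat_poly:
  assumes "\<alpha> \<in> multi_idx k"
  shows "((\<lambda>t. (A_apply k ^^ j) (heat_poly t z) \<alpha>) has_real_derivative
     (A_apply k ^^ Suc j) (heat_poly t z) \<alpha>) (at t)"
  using assms
proof (induction j arbitrary: \<alpha>)
  case 0
  then show ?case using DERIV_heat_poly by simp
next
  case (Suc j)
  have "((\<lambda>t. \<Sum>\<beta>\<in>multi_idx k. A_entry \<alpha> \<beta> * (A_apply k ^^ j) (heat_poly t z) \<beta>) has_real_derivative
      (\<Sum>\<beta>\<in>multi_idx k. A_entry \<alpha> \<beta> * (A_apply k ^^ Suc j) (heat_poly t z) \<beta>)) (at t)"
    by (intro DERIV_sum DERIV_cmult Suc.IH)
  moreover have "(A_apply k ^^ Suc j) v \<alpha> = (\<Sum>\<beta>\<in>multi_idx k. A_entry \<alpha> \<beta> * (A_apply k ^^ j) v \<beta>)" for v j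
    by (simp add: A_apply_def)
  ultimately show ?case by (simp only:)
qed

text \<open>\<open>heat_poly t z\<close> solves the linear ODE \<open>E' = A E\<close>, so \<open>exp (- t A) E(t)\<close> is constant in \<open>t\<close>.\<close>

lemma expmA_heat_poly:
  fixes \<alpha> :: "'n::finite \<Rightarrow> nat"
  assumes \<alpha>: "\<alpha> \<in> multi_idx k"
  shows "expmA k T (heat_poly T z) \<alpha> = mono_pow \<alpha> z"
proof -
  define K where "K = k div 2"
  define g where "g j t = (- t) ^ j / fact j * (A_apply k ^^ Suc j) (heat_poly t z) \<alpha>" for j t
  define F where "F m t = (\<Sum>j\<le>m. (- t) ^ j / fact j * (A_apply k ^^ j) (heat_poly t z) \<alpha>)" for m t
  \<comment> \<open>The derivative of the m-th partial sum telescopes and only its last term g m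
    survives; at m = k div 2 that term contains a power of the matrix that is zero on these
    indices.\<close>
  have der: "(F m has_real_derivative g m t) (at t)" for m t
  proof (induction m)
    case 0
    then show ?case using DERIV_A_iter_heat_poly[OF \<alpha>, of 0 z t] by (simp add: F_def g_def)
  next
    case (Suc m)
    have "((\<lambda>t. (- t) ^ Suc m / fact (Suc m)) has_real_derivative - ((- t) ^ m / fact m)) (at t)"
    proof -
      have "((\<lambda>t. (- t) ^ Suc m / fact (Suc m)) has_real_derivative
          (real (Suc m) * (- t) ^ m * (- 1)) / fact (Suc m)) (at t)"
        by (rule derivative_eq_intros refl | simp)+
      also have "(real (Suc m) * (- t) ^ m * (- 1)) / fact (Suc m) = - ((- t) ^ m / fact m)"
        by (simp add: fact_Suc divide_simps del: of_nat_Suc)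
      finally show ?thesis .
    qed
    from DERIV_mult[OF this DERIV_A_iter_heat_poly[OF \<alpha>, of "Suc m" z t]]
    have "((\<lambda>t. (- t) ^ Suc m / fact (Suc m) * (A_apply k ^^ Suc m) (heat_poly t z) \<alpha>) has_real_derivative
        - g m t + g (Suc m) t) (at t)"
      unfolding g_def by (simp add: algebra_simps)
    from DERIV_add[OF Suc this] show ?case by (simp add: F_def)
  qed
  have "idx_size \<alpha> < 2 * Suc K" using \<alpha> by (simp add: mem_multi_idx K_def)
  then have "g K t = 0" for t
    unfolding g_def by (simp add: A_iter_eq_0[OF \<alpha>] del: funpow.simps)
  then have "\<forall>t. (F K has_real_derivative 0) (at t)" using der[of K] by simp
  from DERIV_isconst_all[OF this, of T 0] have "F K T = F K 0" .
  also have "F K 0 = (\<Sum>j\<le>K. if j = 0 then mono_pow \<alpha> z else 0)"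
    unfolding F_def by (intro sum.cong refl) (auto simp: power_0_left heat_poly_def heat_poly1_at_0 mono_pow_def)
  finally show ?thesis unfolding expmA_finite[OF \<alpha>] F_def K_def[symmetric] by simp
qed

lemma heat_poly1_abs_mono:
  assumes "t \<ge> 0" "\<bar>z\<bar> \<le> R"
  shows "\<bar>heat_poly1 t n z\<bar> \<le> heat_poly1 t n R"
  unfolding heat_poly1_def
proof (rule order_trans[OF sum_abs], rule sum_mono)
  fix j
  have "\<bar>z\<bar> ^ (n - 2 * j) \<le> R ^ (n - 2 * j)" using assms by (intro power_mono) auto
  then have "fact n / (fact (n - 2 * j) * fact j) * t ^ j * \<bar>z\<bar> ^ (n - 2 * j)
      \<le> fact n / (fact (n - 2 * j) * fact j) * t ^ j * R ^ (n - 2 * j)"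
    using assms(1) by (intro mult_left_mono) auto
  then show "\<bar>fact n / (fact (n - 2 * j) * fact j) * t ^ j * z ^ (n - 2 * j)\<bar>
      \<le> fact n / (fact (n - 2 * j) * fact j) * t ^ j * R ^ (n - 2 * j)"
    using assms(1) by (simp add: abs_mult power_abs)
qed

section \<open>Gaussian moments in one and several variables\<close>

text \<open>Expand x^n around the mean z: odd central moments vanish, and the even ones with
  variance 2 T are (2 j)! / j! times T^j. The variance is the one of the heat kernel, whose exponent
  has denominator 4 T.\<close>

lemma has_bochner_integral_normal_power:
  assumes T: "T > 0"
  shows "has_bochner_integral lborel (\<lambda>x. x ^ n * normal_density z (sqrt (2 * T)) x) (heat_poly1 T n z)"
proof -
  define M :: "nat \<Rightarrow> real" where "M r = (if even r then fact r / fact (r div 2) * T ^ (r div 2) else 0)" for r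
  have mom: "has_bochner_integral lborel (\<lambda>x. normal_density z (sqrt (2 * T)) x * (x - z) ^ r) (M r)" for r
  proof (cases "even r")
    case True
    then obtain j where r: "r = 2 * j" by (auto elim: evenE)
    have "2 / (sqrt (2 * T))\<^sup>2 = 1 / T" using T by simp
    then show ?thesis
      using normal_moment_even[of "sqrt (2 * T)" z j] T by (simp add: r M_def power_one_over field_simps)
  next
    case False
    then obtain j where r: "r = 2 * j + 1" by (auto elim: oddE)
    then show ?thesis using normal_moment_odd[of "sqrt (2 * T)" z j] T by (simp add: M_def)
  qed
  have "has_bochner_integral lborel (\<lambda>x. \<Sum>r\<le>n. real (n choose r) * z ^ (n - r) *
      (normal_density z (sqrt (2 * T)) x * (x - z) ^ r)) (\<Sum>r\<le>n. real (n choose r) * z ^ (n - r) * M r)"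
    by (intro has_bochner_integral_sum has_bochner_integral_mult_right mom)
  also have "(\<lambda>x. \<Sum>r\<le>n. real (n choose r) * z ^ (n - r) * (normal_density z (sqrt (2 * T)) x * (x - z) ^ r))
     = (\<lambda>x. x ^ n * normal_density z (sqrt (2 * T)) x)"
  proof
    fix x :: real
    have xn: "x ^ n = (\<Sum>r\<le>n. real (n choose r) * (x - z) ^ r * z ^ (n - r))"
      using binomial_ring[of "x - z" z n] by simp
    show "(\<Sum>r\<le>n. real (n choose r) * z ^ (n - r) * (normal_density z (sqrt (2 * T)) x * (x - z) ^ r))
       = x ^ n * normal_density z (sqrt (2 * T)) x"
      unfolding xn sum_distrib_right by (intro sum.cong refl) (simp only: mult_ac)
  qed
  also have "(\<Sum>r\<le>n. real (n choose r) * z ^ (n - r) * M r) = heat_poly1 T n z"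
  proof -
    have "(\<Sum>r\<le>n. real (n choose r) * z ^ (n - r) * M r)
        = (\<Sum>r\<in>(\<lambda>j. 2 * j) ` {..n div 2}. real (n choose r) * z ^ (n - r) * M r)"
    proof (rule sum.mono_neutral_right)
      show "\<forall>i\<in>{..n} - (\<lambda>j. 2 * j) ` {..n div 2}. real (n choose i) * z ^ (n - i) * M i = 0"
        by (force simp: M_def elim!: evenE)
    qed auto
    also have "\<dots> = (\<Sum>j\<le>n div 2. real (n choose (2 * j)) * z ^ (n - 2 * j) * M (2 * j))"
      by (subst sum.reindex) (auto simp: inj_on_def)
    also have "\<dots> = heat_poly1 T n z"
      unfolding heat_poly1_def
      by (intro sum.cong refl) (auto simp: M_def binomial_fact field_simps)
    finally show ?thesis .
  qed
  finally show ?thesis .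
qed

lemma has_bochner_integral_lborel_prod:
  fixes f :: "'a::euclidean_space \<Rightarrow> real \<Rightarrow> real"
  assumes f: "\<And>b. b \<in> Basis \<Longrightarrow> has_bochner_integral lborel (f b) (I b)"
  shows "has_bochner_integral lborel (\<lambda>x. \<Prod>b\<in>Basis. f b (x \<bullet> b)) (\<Prod>b\<in>Basis. I b)"
proof -
  interpret product_sigma_finite "\<lambda>_::'a. lborel :: real measure"
    by standard
  have [measurable]: "f b \<in> borel_measurable borel" if "b \<in> Basis" for b
    using borel_measurable_has_bochner_integral[OF f[OF that]] by simp
  have int: "integrable lborel (f b)" if "b \<in> Basis" for b
    using f[OF that] by (rule integrable.intros)
  have eq: "(\<Prod>b\<in>Basis. f b ((\<Sum>c\<in>Basis. g c *\<^sub>R c) \<bullet> b)) = (\<Prod>b\<in>Basis. f b (g b))" for g :: "'a \<Rightarrow> real"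
    by (intro prod.cong refl) simp
  have "integrable (distr (\<Pi>\<^sub>M b\<in>Basis. lborel) borel (\<lambda>g. \<Sum>b\<in>Basis. g b *\<^sub>R b)) (\<lambda>x::'a. \<Prod>b\<in>Basis. f b (x \<bullet> b))"
    by (subst integrable_distr_eq) (simp_all add: eq product_integrable_prod int)
  moreover have "integral\<^sup>L (distr (\<Pi>\<^sub>M b\<in>Basis. lborel) borel (\<lambda>g. \<Sum>b\<in>Basis. g b *\<^sub>R b)) (\<lambda>x::'a. \<Prod>b\<in>Basis. f b (x \<bullet> b))
      = (\<Prod>b\<in>Basis. integral\<^sup>L lborel (f b))"
    by (subst integral_distr) (simp_all add: eq product_integral_prod int)
  moreover have "(\<Prod>b\<in>Basis. integral\<^sup>L lborel (f b)) = (\<Prod>b\<in>Basis. I b)"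
    by (intro prod.cong refl has_bochner_integral_integral_eq f)
  ultimately show ?thesis
    unfolding lborel_eq[where 'a='a] by (simp add: has_bochner_integral_iff)
qed

lemma has_bochner_integral_vec_prod:
  fixes f :: "'n::finite \<Rightarrow> real \<Rightarrow> real"
  assumes f: "\<And>i. has_bochner_integral lborel (f i) (I i)"
  shows "has_bochner_integral lborel (\<lambda>x::real^'n. \<Prod>i\<in>UNIV. f i (x $ i)) (\<Prod>i\<in>UNIV. I i)"
proof -
  \<comment> \<open>Inverse of \<open>axis\<close>, needed because the product is indexed by basis
    vectors instead of coordinates.\<close>
  define ix where "ix b = (THE i. b = axis i (1::real))" for b :: "real^'n"
  have ix: "ix (axis i 1) = i" for i by (auto simp: ix_def axis_eq_axis)
  have B: "(\<Prod>b\<in>Basis. h b) = (\<Prod>i\<in>UNIV. h (axis i 1))" for h :: "real^'n \<Rightarrow> real"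
  proof -
    have "(\<Prod>b\<in>Basis. h b) = prod h (range (\<lambda>i. axis i 1))"
      by (rule arg_cong[where f="prod h"]) (auto simp: Basis_vec_def)
    also have "\<dots> = (\<Prod>i\<in>UNIV. h (axis i 1))"
      by (subst prod.reindex) (auto simp: inj_on_def axis_eq_axis)
    finally show ?thesis .
  qed
  have "has_bochner_integral lborel (\<lambda>x::real^'n. \<Prod>b\<in>Basis. f (ix b) (x \<bullet> b)) (\<Prod>b\<in>Basis. I (ix b))"
    by (intro has_bochner_integral_lborel_prod f)
  then show ?thesis by (simp add: B ix inner_axis)
qed

lemma heat_kernel_eq_prod:
  fixes x z :: "real^'n::finite"
  assumes T: "T > 0"
  shows "heat_kernel (x - z) T = (\<Prod>i\<in>UNIV. normal_density (z $ i) (sqrt (2 * T)) (x $ i))"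
proof -
  have "(norm (x - z))\<^sup>2 = (\<Sum>i\<in>UNIV. (x $ i - z $ i)\<^sup>2)"
    by (simp add: norm_vec_def L2_set_def sum_nonneg)
  then have e: "exp (- (norm (x - z))\<^sup>2 / (4 * T)) = (\<Prod>i\<in>UNIV. exp (- (x $ i - z $ i)\<^sup>2 / (4 * T)))"
    by (simp add: exp_sum[symmetric] sum_negf sum_divide_distrib)
  have "(4 * pi * T) powr (- real CARD('n) / 2) = ((4 * pi * T) powr (- 1 / 2)) powr real CARD('n)"
    by (simp add: powr_powr)
  also have "\<dots> = ((4 * pi * T) powr (- 1 / 2)) ^ CARD('n)"
    using T by (intro powr_realpow) simp
  also have "(4 * pi * T) powr (- 1 / 2) = 1 / sqrt (4 * pi * T)"
    using T by (simp add: powr_minus_divide powr_half_sqrt)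
  finally have c: "(4 * pi * T) powr (- real CARD('n) / 2) = (\<Prod>i\<in>(UNIV::'n set). 1 / sqrt (4 * pi * T))"
    by simp
  show ?thesis
    unfolding heat_kernel_def e c prod.distrib[symmetric] normal_density_def
    using T by (intro prod.cong refl) (simp add: mult_ac)
qed

lemma has_bochner_integral_mono_pow_heat_kernel:
  fixes z :: "real^'n::finite"
  assumes T: "T > 0"
  shows "has_bochner_integral lborel (\<lambda>x. mono_pow \<alpha> x * heat_kernel (x - z) T) (heat_poly T z \<alpha>)"
  unfolding heat_kernel_eq_prod[OF T] mono_pow_def prod.distrib[symmetric] heat_poly_def
  by (intro has_bochner_integral_vec_prod[where f="\<lambda>i t. t ^ \<alpha> i * normal_density (z $ i) (sqrt (2 * T)) t"]
      has_bochner_integral_normal_power T)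

section \<open>Signed measures\<close>

text \<open>A class of functions that are integrable against every finite Borel measure, so that
  both components of a signed measure are handled without separate integrability
  assumptions.\<close>

definition bounded_borel :: "(real^'n::finite \<Rightarrow> real) \<Rightarrow> bool" where
  "bounded_borel f \<longleftrightarrow> f \<in> borel_measurable borel \<and> (\<exists>K. \<forall>x. \<bar>f x\<bar> \<le> K)"

lemma integrable_bounded_borel:
  assumes "finite_measure M" "sets M = sets borel" "bounded_borel f"
  shows "integrable M f"
proof -
  interpret finite_measure M by fact
  obtain K where "\<And>x. \<bar>f x\<bar> \<le> K" using assms(3) by (auto simp: bounded_borel_def)
  moreover have "f \<in> borel_measurable M"
    using assms(2,3) by (simp add: bounded_borel_def cong: measurable_cong_sets)
  ultimately show ?thesis by (intro integrable_const_bound[of _ K]) auto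
qed

lemma bounded_borel_diff:
  assumes "bounded_borel f" "bounded_borel g"
  shows "bounded_borel (\<lambda>x. f x - g x)"
proof -
  obtain K L where "\<And>x. \<bar>f x\<bar> \<le> K" "\<And>x. \<bar>g x\<bar> \<le> L" using assms by (auto simp: bounded_borel_def)
  then have "\<bar>f x - g x\<bar> \<le> K + L" for x by (meson abs_triangle_ineq4 add_mono order_trans)
  then show ?thesis using assms by (auto simp: bounded_borel_def)
qed

lemma bounded_borel_indicator_mult:
  assumes "bounded_borel f" "S \<in> sets borel"
  shows "bounded_borel (\<lambda>x. indicator S x * f x)"
proof -
  obtain K where K: "\<And>x. \<bar>f x\<bar> \<le> K" using assms by (auto simp: bounded_borel_def)
  then have "\<bar>indicator S x * f x\<bar> \<le> K" for x
    using order_trans[OF abs_ge_zero K] by (auto simp: indicator_def)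
  then show ?thesis using assms by (auto simp: bounded_borel_def)
qed

lemma bounded_borel_indicator: "S \<in> sets borel \<Longrightarrow> bounded_borel (indicator S)"
  unfolding bounded_borel_def by (auto intro!: exI[of _ 1] simp: indicator_def)

lemma is_fsm_integrable:
  assumes "is_fsm \<mu>" "bounded_borel f"
  shows "integrable (fst \<mu>) f" "integrable (snd \<mu>) f"
  using assms by (auto simp: is_fsm_def intro: integrable_bounded_borel)

lemma sm_val_eq_sm_int:
  assumes "is_fsm \<mu>" "A \<in> sets borel"
  shows "sm_val \<mu> A = sm_int \<mu> (indicator A)"
  using assms by (simp add: sm_val_def sm_int_def is_fsm_def)

lemma sm_int_diff:
  assumes "is_fsm \<mu>" "bounded_borel f" "bounded_borel g"
  shows "sm_int \<mu> (\<lambda>x. f x - g x) = sm_int \<mu> f - sm_int \<mu> g"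
  using is_fsm_integrable[OF assms(1)] assms by (simp add: sm_int_def Bochner_Integration.integral_diff)

lemma sm_int_sum_scale:
  assumes "is_fsm \<mu>" "\<And>i. i \<in> I \<Longrightarrow> bounded_borel (f i)"
  shows "sm_int \<mu> (\<lambda>x. \<Sum>i\<in>I. c i * f i x) = (\<Sum>i\<in>I. c i * sm_int \<mu> (f i))"
proof -
  have "(\<integral>x. (\<Sum>i\<in>I. c i * f i x) \<partial>M) = (\<Sum>i\<in>I. c i * (\<integral>x. f i x \<partial>M))"
    if "M = fst \<mu> \<or> M = snd \<mu>" for M
    using that is_fsm_integrable[OF assms(1)] assms(2)
    by (subst Bochner_Integration.integral_sum) auto
  then show ?thesis by (simp add: sm_int_def sum_subtractf right_diff_distrib)
qed

text \<open>This keeps the \<open>Sup\<close> in \<open>tv_norm\<close> bounded. The total masses on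
  the right may exceed the variation norm, as the two components may overlap.\<close>

lemma sum_abs_sm_val_le:
  assumes "is_fsm \<mu>" "finite F" "disjoint F" "F \<subseteq> sets borel"
  shows "(\<Sum>A\<in>F. \<bar>sm_val \<mu> A\<bar>) \<le> measure (fst \<mu>) UNIV + measure (snd \<mu>) UNIV"
proof -
  have *: "(\<Sum>A\<in>F. measure M A) \<le> measure M UNIV" if M: "finite_measure M" "sets M = sets borel" for M
  proof -
    interpret finite_measure M by fact
    have sp: "space M = UNIV" using sets_eq_imp_space_eq[OF M(2)] by simp
    have "(\<Sum>A\<in>F. measure M A) = measure M (\<Union>A\<in>F. A)"
      using assms M by (intro finite_measure_finite_Union[symmetric])
        (auto simp: disjoint_family_on_def disjoint_def)
    also have "\<dots> \<le> measure M UNIV" using bounded_measure[of "\<Union>A\<in>F. A"] by (simp add: sp)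
    finally show ?thesis .
  qed
  have "(\<Sum>A\<in>F. \<bar>sm_val \<mu> A\<bar>) \<le> (\<Sum>A\<in>F. measure (fst \<mu>) A + measure (snd \<mu>) A)"
    by (intro sum_mono) (auto simp: sm_val_def abs_le_iff)
  also have "\<dots> \<le> measure (fst \<mu>) UNIV + measure (snd \<mu>) UNIV"
    unfolding sum.distrib using assms(1) by (intro add_mono *) (auto simp: is_fsm_def)
  finally show ?thesis .
qed

lemma tv_norm_upper:
  assumes "is_fsm \<mu>" "finite F" "disjoint F" "F \<subseteq> sets borel"
  shows "(\<Sum>A\<in>F. \<bar>sm_val \<mu> A\<bar>) \<le> tv_norm \<mu>"
  unfolding tv_norm_def using assms sum_abs_sm_val_le[OF assms(1)]
  by (intro cSup_upper) (auto simp: bdd_above_def)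

lemma tv_norm_least:
  assumes "\<And>F. finite F \<Longrightarrow> disjoint F \<Longrightarrow> F \<subseteq> sets borel \<Longrightarrow> (\<Sum>A\<in>F. \<bar>sm_val \<mu> A\<bar>) \<le> c"
  shows "tv_norm \<mu> \<le> c"
  unfolding tv_norm_def
  by (rule cSup_least) (use assms in \<open>auto intro!: exI[of _ "{}"]\<close>)

lemma tv_norm_nonneg: "is_fsm \<mu> \<Longrightarrow> 0 \<le> tv_norm \<mu>"
  using tv_norm_upper[of \<mu> "{}"] by simp

text \<open>The pair need not be a Jordan decomposition, so the variation norm is reached only
  through partitions. Rounding f down to multiples of \<epsilon> gives disjoint level sets: one that
  misses S has value 0, one that meets S has level at most c + \<epsilon> in absolute value. The
  rounding error is paid with the full mass m, and \<epsilon> is made small at the end.\<close>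

lemma abs_sm_int_le:
  assumes \<mu>: "is_fsm \<mu>" and S: "sm_supp_in \<mu> S" and f: "bounded_borel f"
    and c: "\<And>x. x \<in> S \<Longrightarrow> \<bar>f x\<bar> \<le> c" and c0: "0 \<le> c"
  shows "\<bar>sm_int \<mu> f\<bar> \<le> c * tv_norm \<mu>"
proof -
  define m where "m = measure (fst \<mu>) UNIV + measure (snd \<mu>) UNIV"
  have [measurable]: "f \<in> borel_measurable borel" using f by (simp add: bounded_borel_def)
  obtain K where K: "\<And>x. \<bar>f x\<bar> \<le> K" using f by (auto simp: bounded_borel_def)
  have step: "\<bar>sm_int \<mu> f\<bar> \<le> (c + \<epsilon>) * tv_norm \<mu> + \<epsilon> * m" if \<epsilon>: "\<epsilon> > 0" for \<epsilon>
  proof -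
    define V where "V = {\<lfloor>- K / \<epsilon>\<rfloor>..\<lfloor>K / \<epsilon>\<rfloor>}"
    define A where "A v = {x. \<lfloor>f x / \<epsilon>\<rfloor> = v}" for v
    define g where "g x = (\<Sum>v\<in>V. (\<epsilon> * real_of_int v) * indicator (A v) x)" for x
    have A[measurable]: "A v \<in> sets borel" for v unfolding A_def by measurable
    have fl: "\<lfloor>f x / \<epsilon>\<rfloor> \<in> V" for x
    proof -
      have "- K / \<epsilon> \<le> f x / \<epsilon>" "f x / \<epsilon> \<le> K / \<epsilon>"
        using K[of x] \<epsilon> by (intro divide_right_mono; linarith)+
      then show ?thesis unfolding V_def atLeastAtMost_iff by (intro conjI floor_mono)
    qed
    have g: "g x = \<epsilon> * real_of_int \<lfloor>f x / \<epsilon>\<rfloor>" for x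
    proof -
      have "g x = (\<Sum>v\<in>V. if v = \<lfloor>f x / \<epsilon>\<rfloor> then \<epsilon> * real_of_int \<lfloor>f x / \<epsilon>\<rfloor> else 0)"
        unfolding g_def by (intro sum.cong refl) (auto simp: A_def indicator_def)
      then show ?thesis using fl[of x] by (simp add: V_def)
    qed
    have fg: "\<bar>f x - \<epsilon> * real_of_int \<lfloor>f x / \<epsilon>\<rfloor>\<bar> \<le> \<epsilon>" for x
    proof -
      have "\<epsilon> * real_of_int \<lfloor>f x / \<epsilon>\<rfloor> \<le> \<epsilon> * (f x / \<epsilon>)" "\<epsilon> * (f x / \<epsilon>) \<le> \<epsilon> * (real_of_int \<lfloor>f x / \<epsilon>\<rfloor> + 1)"
        using \<epsilon> by (intro mult_left_mono; linarith)+
      then show ?thesis using \<epsilon> by (simp add: abs_le_iff algebra_simps)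
    qed
    have gb: "bounded_borel g"
      unfolding bounded_borel_def
    proof (intro conjI exI allI)
      show "g \<in> borel_measurable borel" unfolding g_def by measurable
      show "\<bar>g x\<bar> \<le> K + \<epsilon>" for x using fg[of x] K[of x] unfolding g by linarith
    qed
    have "sm_int \<mu> g = (\<Sum>v\<in>V. (\<epsilon> * real_of_int v) * sm_val \<mu> (A v))"
      unfolding g_def sm_val_eq_sm_int[OF \<mu> A]
      by (rule sm_int_sum_scale[OF \<mu>]) (intro bounded_borel_indicator A)
    also have "\<bar>\<dots>\<bar> \<le> (\<Sum>v\<in>V. (c + \<epsilon>) * \<bar>sm_val \<mu> (A v)\<bar>)"
    proof (rule order_trans[OF sum_abs], rule sum_mono)
      fix v
      show "\<bar>(\<epsilon> * real_of_int v) * sm_val \<mu> (A v)\<bar> \<le> (c + \<epsilon>) * \<bar>sm_val \<mu> (A v)\<bar>"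
      proof (cases "A v \<inter> S = {}")
        case True
        then show ?thesis using S A by (simp add: sm_supp_in_def)
      next
        case False
        then obtain x where x: "x \<in> S" "\<lfloor>f x / \<epsilon>\<rfloor> = v" by (auto simp: A_def)
        then have "\<bar>\<epsilon> * real_of_int v\<bar> \<le> c + \<epsilon>" using fg[of x] c[of x] by auto
        then show ?thesis by (simp add: abs_mult mult_right_mono del: abs_mult_pos)
      qed
    qed
    also have "\<dots> = (c + \<epsilon>) * (\<Sum>B\<in>A ` V. \<bar>sm_val \<mu> B\<bar>)"
    proof -
      have "(\<Sum>B\<in>A ` V. \<bar>sm_val \<mu> B\<bar>) = (\<Sum>v\<in>V. \<bar>sm_val \<mu> (A v)\<bar>)"
      \<comment> \<open>\<open>A\<close> need not be injective: several levels may have empty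
        preimage, but those contribute 0.\<close>
      proof (subst sum.reindex_nontrivial)
        show "finite V" by (simp add: V_def)
        fix v w assume "v \<noteq> w" "A v = A w"
        then have "A v = {}" by (auto simp: A_def)
        then show "\<bar>sm_val \<mu> (A v)\<bar> = 0" by (simp add: sm_val_def)
      qed simp
      then show ?thesis by (simp add: sum_distrib_left)
    qed
    also have "\<dots> \<le> (c + \<epsilon>) * tv_norm \<mu>"
      using c0 \<epsilon> by (intro mult_left_mono tv_norm_upper[OF \<mu>])
        (auto simp: V_def disjoint_def A_def intro: A[unfolded A_def])
    finally have 1: "\<bar>sm_int \<mu> g\<bar> \<le> (c + \<epsilon>) * tv_norm \<mu>" .
    have int_le: "\<bar>\<integral>x. (f x - g x) \<partial>M\<bar> \<le> \<epsilon> * measure M UNIV"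
      if M: "finite_measure M" "sets M = sets borel" for M
    proof -
      interpret finite_measure M by fact
      have sp: "space M = UNIV" using sets_eq_imp_space_eq[OF M(2)] by simp
      have "\<bar>\<integral>x. (f x - g x) \<partial>M\<bar> \<le> (\<integral>x. \<bar>f x - g x\<bar> \<partial>M)" by (rule integral_abs_bound)
      also have "\<dots> \<le> (\<integral>x. \<epsilon> \<partial>M)"
        using integrable_bounded_borel[OF M bounded_borel_diff[OF f gb]] fg
        by (intro integral_mono) (auto simp: g)
      finally show ?thesis by (simp add: sp mult.commute)
    qed
    have "\<bar>sm_int \<mu> (\<lambda>x. f x - g x)\<bar> \<le> \<epsilon> * m"
      using int_le[of "fst \<mu>"] int_le[of "snd \<mu>"] \<mu>
      unfolding sm_int_def m_def is_fsm_def by (auto simp: algebra_simps)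
    then show ?thesis using 1 unfolding sm_int_diff[OF \<mu> f gb] by linarith
  qed
  have m0: "m \<ge> 0" by (simp add: m_def)
  have t0: "tv_norm \<mu> \<ge> 0" by (rule tv_norm_nonneg[OF \<mu>])
  show ?thesis
  proof (rule field_le_epsilon)
    fix e :: real assume e: "e > 0"
    \<comment> \<open>Both error terms are linear in \<epsilon>; the added 1 keeps the denominator
      positive when the other two terms vanish.\<close>
    define \<epsilon> where "\<epsilon> = e / (tv_norm \<mu> + m + 1)"
    have "\<epsilon> > 0" using e m0 t0 by (simp add: \<epsilon>_def)
    from step[OF this] have "\<bar>sm_int \<mu> f\<bar> \<le> c * tv_norm \<mu> + \<epsilon> * (tv_norm \<mu> + m)"
      by (simp add: algebra_simps)
    also have "\<epsilon> * (tv_norm \<mu> + m) \<le> e"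
      using e m0 t0 by (simp add: \<epsilon>_def divide_le_eq mult_left_mono)
    finally show "\<bar>sm_int \<mu> f\<bar> \<le> c * tv_norm \<mu> + e" by simp
  qed
qed

text \<open>The two components may each charge the complement of S, but the difference of the
  integrands vanishes on S, so the previous bound applies with c = 0.\<close>

lemma sm_int_restrict:
  assumes "is_fsm \<mu>" "sm_supp_in \<mu> S" "bounded_borel f" "S \<in> sets borel"
  shows "sm_int \<mu> (\<lambda>x. indicator S x * f x) = sm_int \<mu> f"
proof -
  have b: "bounded_borel (\<lambda>x. indicator S x * f x)" by (rule bounded_borel_indicator_mult) fact+
  have "\<bar>sm_int \<mu> (\<lambda>x. indicator S x * f x - f x)\<bar> \<le> 0 * tv_norm \<mu>"
    by (rule abs_sm_int_le[OF assms(1,2) bounded_borel_diff[OF b assms(3)]]) auto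
  then show ?thesis using sm_int_diff[OF assms(1) b assms(3)] by simp
qed

section \<open>Adding finitely many point masses to a signed measure\<close>

definition add_measure :: "(real^'n::finite) measure \<Rightarrow> (real^'n) measure \<Rightarrow> (real^'n) measure" where
  "add_measure M N = measure_of UNIV (sets borel) (\<lambda>A. emeasure M A + emeasure N A)"

lemma sets_add_measure [simp, measurable_cong]: "sets (add_measure M N) = sets borel"
  unfolding add_measure_def using sets.sigma_sets_eq[of borel] by (simp add: sets_measure_of)

lemma space_add_measure [simp]: "space (add_measure M N) = UNIV"
  unfolding add_measure_def by (simp add: space_measure_of)

lemma emeasure_add_measure:
  assumes "sets M = sets borel" "sets N = sets borel" "A \<in> sets borel"
  shows "emeasure (add_measure M N) A = emeasure M A + emeasure N A"
  unfolding add_measure_def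
proof (rule emeasure_measure_of_sigma)
  show "sigma_algebra UNIV (sets borel)" by (metis sets.sigma_algebra_axioms space_borel)
  show "countably_additive (sets borel) (\<lambda>A. emeasure M A + emeasure N A)"
  proof (rule countably_additiveI)
    fix B :: "nat \<Rightarrow> (real^'a) set"
    assume B: "range B \<subseteq> sets borel" "disjoint_family B"
    have "(\<Sum>i. emeasure M (B i) + emeasure N (B i)) = (\<Sum>i. emeasure M (B i)) + (\<Sum>i. emeasure N (B i))"
      by (intro suminf_add[symmetric]) auto
    then show "(\<Sum>i. emeasure M (B i) + emeasure N (B i)) = emeasure M (\<Union> (range B)) + emeasure N (\<Union> (range B))"
      using assms B by (simp add: suminf_emeasure)
  qed
qed (use assms in \<open>auto simp: positive_def\<close>)

lemma finite_measure_add_measure: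
  assumes "sets M = sets borel" "sets N = sets borel" "finite_measure M" "finite_measure N"
  shows "finite_measure (add_measure M N)"
proof (rule finite_measureI)
  have "space M = UNIV" "space N = UNIV" using assms(1,2)[THEN sets_eq_imp_space_eq] by auto
  then show "emeasure (add_measure M N) (space (add_measure M N)) \<noteq> \<infinity>"
    using assms finite_measure.emeasure_finite[of M UNIV] finite_measure.emeasure_finite[of N UNIV]
    by (simp add: emeasure_add_measure)
qed

lemma nn_integral_add_measure:
  assumes M: "sets M = sets borel" "sets N = sets borel" and f: "f \<in> borel_measurable borel"
  shows "(\<integral>\<^sup>+x. f x \<partial>add_measure M N) = (\<integral>\<^sup>+x. f x \<partial>M) + (\<integral>\<^sup>+x. f x \<partial>N)"
  using f
proof (induction f rule: borel_measurable_induct)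
  case (cong f g)
  then show ?case by (metis ext space_borel UNIV_I)
next
  case (set A)
  then show ?case using M by (simp add: emeasure_add_measure)
next
  case (mult u c)
  then show ?case using M by (simp add: nn_integral_cmult distrib_left cong: measurable_cong_sets)
next
  case (add u v)
  then show ?case using M by (simp add: nn_integral_add ac_simps cong: measurable_cong_sets)
next
  case (seq U)
  have [measurable]: "U i \<in> borel_measurable M" "U i \<in> borel_measurable N" for i
    using seq(1) M by (simp_all cong: measurable_cong_sets)
  have [measurable]: "U i \<in> borel_measurable (add_measure M N)" for i
    using seq(1) by (simp cong: measurable_cong_sets)
  have "(\<integral>\<^sup>+x. (SUP i. U i) x \<partial>K) = (SUP i. \<integral>\<^sup>+x. U i x \<partial>K)"
    if "\<And>i. U i \<in> borel_measurable K" for K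
    unfolding SUP_apply using seq(3) that by (rule nn_integral_monotone_convergence_SUP)
  then show ?case
    using seq.IH seq(3,4)
    by (simp add: ennreal_SUP_add incseq_nn_integral)
qed

lemma integral_add_measure:
  assumes M: "sets M = sets borel" "sets N = sets borel" "finite_measure M" "finite_measure N"
    and f: "bounded_borel f"
  shows "(\<integral>x. f x \<partial>add_measure M N) = (\<integral>x. f x \<partial>M) + (\<integral>x. f x \<partial>N)"
proof -
  have [measurable]: "f \<in> borel_measurable borel" using f by (simp add: bounded_borel_def)
  have i: "integrable M f" "integrable N f" "integrable (add_measure M N) f"
    using M f by (auto intro!: integrable_bounded_borel finite_measure_add_measure)
  have fin: "(\<integral>\<^sup>+x. ennreal (f x) \<partial>K) < \<infinity>" "(\<integral>\<^sup>+x. ennreal (- f x) \<partial>K) < \<infinity>" if "integrable K f" for K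
    using that by (auto simp: real_integrable_def less_top)
  show ?thesis
    unfolding real_lebesgue_integral_def[OF i(1)] real_lebesgue_integral_def[OF i(2)]
      real_lebesgue_integral_def[OF i(3)]
    using M fin[OF i(1)] fin[OF i(2)]
    by (simp add: nn_integral_add_measure enn2real_plus)
qed

text \<open>As an image of a weighted counting measure it lets coinciding points simply add their
  weights, so distinctness of the points is never at issue.\<close>

definition point_masses :: "'j set \<Rightarrow> ('j \<Rightarrow> real) \<Rightarrow> ('j \<Rightarrow> real^'n::finite) \<Rightarrow> (real^'n) measure" where
  "point_masses J w x = distr (point_measure J (\<lambda>j. ennreal (w j))) borel x"

lemma sets_point_masses [simp, measurable_cong]: "sets (point_masses J w x) = sets borel"
  by (simp add: point_masses_def)

lemma finite_measure_point_masses: "finite J \<Longrightarrow> finite_measure (point_masses J w x)"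
  unfolding point_masses_def
  by (intro finite_measure.finite_measure_distr finite_measureI)
    (auto simp: space_point_measure emeasure_point_measure_finite)

lemma integral_point_masses:
  assumes "finite J" "\<And>j. j \<in> J \<Longrightarrow> w j \<ge> 0" "f \<in> borel_measurable borel"
  shows "(\<integral>z. f z \<partial>point_masses J w x) = (\<Sum>j\<in>J. w j * f (x j))"
  unfolding point_masses_def using assms
  by (subst integral_distr) (auto simp: lebesgue_integral_point_measure_finite)

text \<open>Positive parts of the weights join the first component and negative parts the second, so
  both remain measures.\<close>

definition sm_add_points :: "('n::finite) sm \<Rightarrow> 'j set \<Rightarrow> ('j \<Rightarrow> real) \<Rightarrow> ('j \<Rightarrow> real^'n) \<Rightarrow> 'n sm" where
  "sm_add_points \<mu> J w x =
     (add_measure (fst \<mu>) (point_masses J (\<lambda>j. max 0 (w j)) x),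
      add_measure (snd \<mu>) (point_masses J (\<lambda>j. max 0 (- w j)) x))"

lemma is_fsm_add_points: "is_fsm \<mu> \<Longrightarrow> finite J \<Longrightarrow> is_fsm (sm_add_points \<mu> J w x)"
  by (auto simp: is_fsm_def sm_add_points_def finite_measure_add_measure finite_measure_point_masses)

lemma sm_int_add_points:
  assumes "is_fsm \<mu>" "finite J" "bounded_borel f"
  shows "sm_int (sm_add_points \<mu> J w x) f = sm_int \<mu> f + (\<Sum>j\<in>J. w j * f (x j))"
proof -
  have "(\<Sum>j\<in>J. w j * f (x j)) = (\<Sum>j\<in>J. max 0 (w j) * f (x j)) - (\<Sum>j\<in>J. max 0 (- w j) * f (x j))"
    unfolding sum_subtractf[symmetric] by (intro sum.cong refl) (auto simp: max_def)
  then show ?thesis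
    using assms unfolding sm_int_def sm_add_points_def is_fsm_def
    by (simp add: integral_add_measure finite_measure_point_masses integral_point_masses bounded_borel_def)
qed

lemma sm_val_add_points:
  assumes "is_fsm \<mu>" "finite J" "A \<in> sets borel"
  shows "sm_val (sm_add_points \<mu> J w x) A = sm_val \<mu> A + (\<Sum>j\<in>J. w j * indicator A (x j))"
  using assms
  by (simp add: sm_val_eq_sm_int is_fsm_add_points sm_int_add_points bounded_borel_indicator)

lemma sm_supp_in_add_points:
  assumes "is_fsm \<mu>" "finite J" "sm_supp_in \<mu> S" "\<And>j. j \<in> J \<Longrightarrow> x j \<in> S"
  shows "sm_supp_in (sm_add_points \<mu> J w x) S"
  unfolding sm_supp_in_def
proof (intro ballI impI)
  fix A :: "(real^'a) set" assume A: "A \<in> sets borel" "A \<inter> S = {}"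
  have "(\<Sum>j\<in>J. w j * indicator A (x j)) = 0"
    using A(2) assms(4) by (intro sum.neutral) (auto simp: indicator_def)
  then show "sm_val (sm_add_points \<mu> J w x) A = 0"
    using A assms by (simp add: sm_val_add_points sm_supp_in_def)
qed

text \<open>Each point lies in at most one set of a disjoint family, so its weight is counted at
  most once.\<close>

lemma tv_norm_add_points_le:
  assumes "is_fsm \<mu>" "finite J"
  shows "tv_norm (sm_add_points \<mu> J w x) \<le> tv_norm \<mu> + (\<Sum>j\<in>J. \<bar>w j\<bar>)"
proof (rule tv_norm_least)
  fix F :: "(real^'a) set set" assume F: "finite F" "disjoint F" "F \<subseteq> sets borel"
  have "(\<Sum>A\<in>F. \<bar>sm_val (sm_add_points \<mu> J w x) A\<bar>)
      \<le> (\<Sum>A\<in>F. \<bar>sm_val \<mu> A\<bar> + (\<Sum>j\<in>J. \<bar>w j\<bar> * indicator A (x j)))"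
  proof (rule sum_mono)
    fix A assume "A \<in> F"
    then have "A \<in> sets borel" using F by blast
    have "\<bar>\<Sum>j\<in>J. w j * indicator A (x j)\<bar> \<le> (\<Sum>j\<in>J. \<bar>w j\<bar> * indicator A (x j))"
      by (rule order_trans[OF sum_abs]) (simp add: abs_mult)
    then show "\<bar>sm_val (sm_add_points \<mu> J w x) A\<bar> \<le> \<bar>sm_val \<mu> A\<bar> + (\<Sum>j\<in>J. \<bar>w j\<bar> * indicator A (x j))"
      unfolding sm_val_add_points[OF assms \<open>A \<in> sets borel\<close>] by linarith
  qed
  also have "\<dots> = (\<Sum>A\<in>F. \<bar>sm_val \<mu> A\<bar>) + (\<Sum>j\<in>J. \<bar>w j\<bar> * (\<Sum>A\<in>F. indicator A (x j)))"
    unfolding sum.distrib sum_distrib_left by (subst sum.swap) simp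
  also have "\<dots> \<le> tv_norm \<mu> + (\<Sum>j\<in>J. \<bar>w j\<bar> * 1)"
  proof (intro add_mono tv_norm_upper assms F sum_mono mult_left_mono)
    fix j
    have "(\<Sum>A\<in>F. indicator A (x j)) = real (card {A\<in>F. x j \<in> A})"
      using F(1) by (simp add: indicator_def sum.If_cases Int_def)
    also have "card {A\<in>F. x j \<in> A} \<le> 1"
      using F by (auto simp: card_le_Suc0_iff_eq disjoint_def)
    finally show "(\<Sum>A\<in>F. indicator A (x j)) \<le> (1::real)" by simp
  qed auto
  finally show "(\<Sum>A\<in>F. \<bar>sm_val (sm_add_points \<mu> J w x) A\<bar>) \<le> tv_norm \<mu> + (\<Sum>j\<in>J. \<bar>w j\<bar>)" by simp
qed

section \<open>Moments of the heat solution\<close>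

lemma cube_eq_cbox: "cube R = cbox (\<chi> i. - R) (\<chi> i. R)"
  by (auto simp: cube_def mem_box_cart abs_le_iff minus_le_iff)

lemma closed_cube: "closed (cube R)"
  by (simp add: cube_eq_cbox closed_cbox)

lemma cube_borel [measurable]: "cube R \<in> sets borel"
  by (simp add: closed_cube borel_closed)

lemma continuous_mono_pow: "continuous_on S (mono_pow \<alpha>)"
  unfolding mono_pow_def by (intro continuous_intros)

lemma borel_measurable_mono_pow [measurable]: "mono_pow \<alpha> \<in> borel_measurable borel"
  by (rule borel_measurable_continuous_onI) (rule continuous_mono_pow)

lemma bounded_borel_cube_continuous:
  fixes v :: "real^'n::finite \<Rightarrow> real"
  assumes "continuous_on (cube R) v"
  shows "bounded_borel (\<lambda>x. indicator (cube R) x * v x)"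
  unfolding bounded_borel_def
proof
  show "(\<lambda>x. indicator (cube R) x * v x) \<in> borel_measurable borel"
    using borel_measurable_continuous_on_indicator[OF cube_borel assms] by simp
  have "bounded (v ` cube R)"
    using assms by (intro compact_imp_bounded compact_continuous_image) (simp_all add: cube_eq_cbox)
  then obtain B where B: "\<And>x. x \<in> cube R \<Longrightarrow> \<bar>v x\<bar> \<le> B" by (auto simp: bounded_iff)
  have "\<bar>indicator (cube R) x * v x\<bar> \<le> max B 0" for x
    using B[of x] by (auto simp: indicator_def)
  then show "\<exists>K. \<forall>x. \<bar>indicator (cube R) x * v x\<bar> \<le> K" by blast
qed

lemma heat_kernel_nonneg: "heat_kernel x T \<ge> 0"
  by (simp add: heat_kernel_def)

lemma continuous_heat_kernel: "continuous_on S (\<lambda>x. heat_kernel x T)"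
  unfolding heat_kernel_def divide_inverse by (intro continuous_intros)

lemma borel_measurable_heat_kernel [measurable]: "(\<lambda>x. heat_kernel x T) \<in> borel_measurable borel"
  by (rule borel_measurable_continuous_onI) (rule continuous_heat_kernel)

lemma bounded_borel_heat_kernel:
  assumes "T > 0"
  shows "bounded_borel (\<lambda>z. heat_kernel (x - z) T)"
  unfolding bounded_borel_def
proof (intro conjI exI allI)
  show "(\<lambda>z. heat_kernel (x - z) T) \<in> borel_measurable borel" by measurable
  show "\<bar>heat_kernel (x - z) T\<bar> \<le> (4 * pi * T) powr (- real CARD('a) / 2)" for z
    using assms unfolding heat_kernel_def by (simp add: abs_mult mult_left_le)
qed

lemma continuous_heat_poly: "continuous_on S (\<lambda>z. heat_poly T z \<alpha>)"
  unfolding heat_poly_def heat_poly1_def by (intro continuous_intros)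

text \<open>The indicator confines z to the cube, where the Gaussian moments are uniformly bounded;
  \<open>M\<close> itself may have mass far away, with no finite moments.\<close>

lemma Fubini_heat_moment:
  fixes M :: "(real^'n::finite) measure"
  assumes M: "finite_measure M" "sets M = sets borel" and T: "T > 0" and R: "R \<ge> 0"
  shows "has_bochner_integral lborel
    (\<lambda>x. mono_pow \<alpha> x * (\<integral>z. indicator (cube R) z * heat_kernel (x - z) T \<partial>M))
    (\<integral>z. indicator (cube R) z * heat_poly T z \<alpha> \<partial>M)"
proof -
  interpret M: finite_measure M by fact
  interpret pair_sigma_finite M lborel ..
  note [measurable_cong] = M(2)
  define f where "f z x = indicator (cube R) z * (mono_pow \<alpha> x * heat_kernel (x - z) T)" for z x :: "real^'n"
  have f[measurable]: "case_prod f \<in> borel_measurable (M \<Otimes>\<^sub>M lborel)"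
    unfolding f_def by measurable
  have hb: "has_bochner_integral lborel (f z) (indicator (cube R) z * heat_poly T z \<alpha>)" for z
    unfolding f_def by (intro has_bochner_integral_mult_right has_bochner_integral_mono_pow_heat_kernel T)
  have "integrable M (\<lambda>z. \<integral>x. norm (f z x) \<partial>lborel)"
  proof (rule M.integrable_const_bound)
    show "(\<lambda>z. \<integral>x. norm (f z x) \<partial>lborel) \<in> borel_measurable M"
      by (rule lborel.borel_measurable_lebesgue_integral) measurable
    define B where "B = (\<Prod>i\<in>(UNIV :: 'n set). heat_poly1 T 0 R) + (\<Prod>i\<in>UNIV. heat_poly1 T (2 * \<alpha> i) R)"
    have hp: "\<bar>heat_poly T z \<beta>\<bar> \<le> (\<Prod>i\<in>UNIV. heat_poly1 T (\<beta> i) R)" if "z \<in> cube R" for z :: "real^'n" and \<beta>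
      unfolding heat_poly_def abs_prod using that T
      by (intro prod_mono conjI abs_ge_zero heat_poly1_abs_mono) (auto simp: cube_def)
    show "AE z in M. norm (\<integral>x. norm (f z x) \<partial>lborel) \<le> B"
    proof (rule AE_I2)
      fix z
      have "norm (f z x) \<le> indicator (cube R) z *
          (mono_pow (\<lambda>_. 0) x * heat_kernel (x - z) T + mono_pow (\<lambda>i. 2 * \<alpha> i) x * heat_kernel (x - z) T)" for x
      proof -
        \<comment> \<open>An absolute monomial has no polynomial integral, but |t| \<le> 1 + t^2
          dominates it by the monomials with exponents 0 and 2 \<alpha>, whose integrals are heat
          polynomials.\<close>
        have t: "\<bar>t\<bar> \<le> 1 + t\<^sup>2" for t :: real
          using sum_squares_ge_zero[of "\<bar>t\<bar> - 1" 1] zero_le_square[of t]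
          by (simp add: power2_eq_square algebra_simps del: zero_le_square)
        have "mono_pow (\<lambda>i. 2 * \<alpha> i) x = (mono_pow \<alpha> x)\<^sup>2"
          unfolding mono_pow_def prod_power_distrib by (simp only: power_mult[symmetric] mult.commute)
        note sq = this
        have "\<bar>mono_pow \<alpha> x\<bar> \<le> mono_pow (\<lambda>_. 0) x + mono_pow (\<lambda>i. 2 * \<alpha> i) x"
          using t[of "mono_pow \<alpha> x"] unfolding sq by (simp add: mono_pow_def)
        from mult_right_mono[OF this heat_kernel_nonneg[of "x - z" T]] show ?thesis
          by (simp add: f_def abs_mult heat_kernel_nonneg mult_left_mono distrib_right)
      qed
      note le = this
      have hb2: "has_bochner_integral lborel (\<lambda>x. indicator (cube R) z *
          (mono_pow (\<lambda>_. 0) x * heat_kernel (x - z) T + mono_pow (\<lambda>i. 2 * \<alpha> i) x * heat_kernel (x - z) T))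
          (indicator (cube R) z * (heat_poly T z (\<lambda>_. 0) + heat_poly T z (\<lambda>i. 2 * \<alpha> i)))"
        by (intro has_bochner_integral_mult_right has_bochner_integral_add
            has_bochner_integral_mono_pow_heat_kernel T)
      have "(\<integral>x. norm (f z x) \<partial>lborel) \<le> (\<integral>x. indicator (cube R) z *
          (mono_pow (\<lambda>_. 0) x * heat_kernel (x - z) T + mono_pow (\<lambda>i. 2 * \<alpha> i) x * heat_kernel (x - z) T) \<partial>lborel)"
        by (rule integral_mono[OF integrable_norm[OF integrable.intros[OF hb]] integrable.intros[OF hb2] le])
      also have "\<dots> = indicator (cube R) z * (heat_poly T z (\<lambda>_. 0) + heat_poly T z (\<lambda>i. 2 * \<alpha> i))"
        by (rule has_bochner_integral_integral_eq[OF hb2])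
      also have "\<dots> \<le> B"
      proof (cases "z \<in> cube R")
        case True
        then show ?thesis using hp[OF True, of "\<lambda>_. 0"] hp[OF True, of "\<lambda>i. 2 * \<alpha> i"] by (simp add: B_def)
      next
        case False
        have "heat_poly1 T n R \<ge> 0" for n
          unfolding heat_poly1_def using T R by (intro sum_nonneg) simp
        then show ?thesis using False by (simp add: B_def prod_nonneg)
      qed
      finally show "norm (\<integral>x. norm (f z x) \<partial>lborel) \<le> B"
        by (simp add: integral_nonneg_AE)
    qed
  qed
  then have int: "integrable (M \<Otimes>\<^sub>M lborel) (case_prod f)"
    using hb by (intro Fubini_integrable f) (auto simp: has_bochner_integral_iff)
  have "integrable lborel (\<lambda>x. \<integral>z. f z x \<partial>M)" using integrable_snd[OF int] .
  moreover have "(\<integral>x. (\<integral>z. f z x \<partial>M) \<partial>lborel) = (\<integral>z. (\<integral>x. f z x \<partial>lborel) \<partial>M)"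
    by (rule Fubini_integral[OF int])
  moreover have "(\<integral>x. f z x \<partial>lborel) = indicator (cube R) z * heat_poly T z \<alpha>" for z
    using hb by (rule has_bochner_integral_integral_eq)
  moreover have "(\<integral>z. f z x \<partial>M) = mono_pow \<alpha> x * (\<integral>z. indicator (cube R) z * heat_kernel (x - z) T \<partial>M)" for x
    unfolding f_def by (subst integral_mult_right_zero[symmetric]) (simp add: mult_ac)
  ultimately show ?thesis by (simp add: has_bochner_integral_iff)
qed

lemma heat_moment:
  fixes \<mu> :: "('n::finite) sm"
  assumes \<mu>: "is_fsm \<mu>" and S: "sm_supp_in \<mu> (cube R)" and T: "T > 0" and R: "R \<ge> 0"
  shows "(\<integral>x. mono_pow \<alpha> x * heat_sol \<mu> x T \<partial>lborel)
    = sm_int \<mu> (\<lambda>z. indicator (cube R) z * heat_poly T z \<alpha>)"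
proof -
  have P: "finite_measure (fst \<mu>)" "sets (fst \<mu>) = sets borel"
    and N: "finite_measure (snd \<mu>)" "sets (snd \<mu>) = sets borel"
    using \<mu> by (auto simp: is_fsm_def)
  have "mono_pow \<alpha> x * heat_sol \<mu> x T
      = mono_pow \<alpha> x * (\<integral>z. indicator (cube R) z * heat_kernel (x - z) T \<partial>fst \<mu>)
      - mono_pow \<alpha> x * (\<integral>z. indicator (cube R) z * heat_kernel (x - z) T \<partial>snd \<mu>)" for x
    unfolding heat_sol_def sm_int_restrict[OF \<mu> S bounded_borel_heat_kernel[OF T] cube_borel, symmetric]
    by (simp add: sm_int_def right_diff_distrib)
  then show ?thesis
    using has_bochner_integral_diff[OF Fubini_heat_moment[OF P T R, of \<alpha>] Fubini_heat_moment[OF N T R, of \<alpha>]]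
    by (simp add: sm_int_def has_bochner_integral_iff)
qed

text \<open>As a finite linear form the matrix exponential passes under the integral over the
  initial measure, where it turns heat polynomials back into monomials. On moments the heat flow is
  thus inverted exactly.\<close>

lemma expmA_heat_moment:
  fixes \<mu> :: "('n::finite) sm"
  assumes \<mu>: "is_fsm \<mu>" and S: "sm_supp_in \<mu> (cube R)" and T: "T > 0" and R: "R \<ge> 0"
    and \<alpha>: "\<alpha> \<in> multi_idx k"
  shows "expmA k T (\<lambda>\<beta>. \<integral>x. mono_pow \<beta> x * heat_sol \<mu> x T \<partial>lborel) \<alpha>
    = sm_int \<mu> (\<lambda>z. indicator (cube R) z * mono_pow \<alpha> z)"
proof -
  obtain a where a: "\<And>v. expmA k T v \<alpha> = (\<Sum>\<beta>\<in>multi_idx k. a \<beta> * v \<beta>)"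
    using expmA_linear[OF \<alpha>] by blast
  have "expmA k T (\<lambda>\<beta>. \<integral>x. mono_pow \<beta> x * heat_sol \<mu> x T \<partial>lborel) \<alpha>
      = sm_int \<mu> (\<lambda>z. \<Sum>\<beta>\<in>multi_idx k. a \<beta> * (indicator (cube R) z * heat_poly T z \<beta>))"
    unfolding a heat_moment[OF \<mu> S T R]
    by (rule sm_int_sum_scale[OF \<mu>, symmetric]) (intro bounded_borel_cube_continuous continuous_heat_poly)
  also have "(\<lambda>z. \<Sum>\<beta>\<in>multi_idx k. a \<beta> * (indicator (cube R) z * heat_poly T z \<beta>))
      = (\<lambda>z. indicator (cube R) z * expmA k T (heat_poly T z) \<alpha>)"
    unfolding a by (simp add: sum_distrib_left mult_ac)
  finally show ?thesis by (simp add: expmA_heat_poly[OF \<alpha>])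
qed

lemma expmA_obs_err:
  fixes \<mu> :: "('n::finite) sm"
  assumes "is_fsm \<mu>" "sm_supp_in \<mu> (cube R)" "T > 0" "R \<ge> 0" and \<alpha>: "\<alpha> \<in> multi_idx k"
  shows "expmA k T (obs_err k T y \<mu>) \<alpha>
    = expmA k T y \<alpha> - sm_int \<mu> (\<lambda>z. indicator (cube R) z * mono_pow \<alpha> z)"
proof -
  obtain a where a: "\<And>v. expmA k T v \<alpha> = (\<Sum>\<beta>\<in>multi_idx k. a \<beta> * v \<beta>)"
    using expmA_linear[OF \<alpha>] by blast
  show ?thesis
    unfolding expmA_heat_moment[OF assms, symmetric] a obs_err_def
    by (simp add: right_diff_distrib sum_subtractf)
qed

text \<open>Row 0 of the matrix vanishes, as heat flow conserves total mass. This is why a constant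
  test function meets the observation error without amplification.\<close>

lemma expmA_zero_index: "expmA k T y (\<lambda>_. 0) = y (\<lambda>_. 0)"
proof -
  have 0: "(\<lambda>_. 0) \<in> multi_idx k" by (simp add: multi_idx_def)
  have "(A_apply k ^^ j) y (\<lambda>_. 0) = 0" if "j \<noteq> 0" for j
    using that by (intro A_iter_eq_0[OF 0]) (simp add: idx_size_def)
  then have "expmA k T y (\<lambda>_. 0) = (\<Sum>j\<le>k div 2. if j = 0 then y (\<lambda>_. 0) else 0)"
    unfolding expmA_finite[OF 0] by (intro sum.cong refl) auto
  then show ?thesis by simp
qed

section \<open>The error bound\<close>

text \<open>As 2 < e, the surplus exp (\<delta> k) with \<delta> = 1 - ln 2 beats every power of k,
  with a constant depending on d only.\<close>

lemma power_times_two_power_le_exp: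
  obtains D where "D > 0"
    "\<And>k::nat. sqrt (pi * real k) * (2 * real (Suc k)) ^ d * 2 ^ k \<le> D * exp (real k)"
proof -
  define \<delta> where "\<delta> = 1 - ln (2::real)"
  have \<delta>: "\<delta> > 0" using ln_2_less_1 by (simp add: \<delta>_def)
  \<comment> \<open>The left side carries d + 1 factors of size k + 1, the square root being bounded
    by pi (k + 1). Each factor is at most exp (c (k + 1)) / c, so together they use up exactly the
    surplus \<delta>; the shift from k to k + 1 is the factor exp \<delta> in D.\<close>
  define c where "c = \<delta> / real (Suc d)"
  have c: "c > 0" using \<delta> by (simp add: c_def)
  define D where "D = pi * 2 ^ d * (1 / c) ^ Suc d * exp \<delta>"
  have "sqrt (pi * real k) * (2 * real (Suc k)) ^ d * 2 ^ k \<le> D * exp (real k)" for k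
  proof -
    have "pi * real k \<le> (pi * real (Suc k)) * (pi * real (Suc k))"
    proof -
      have 1: "1 \<le> pi * real (Suc k)"
        using mult_mono[of 1 pi 1 "real (Suc k)"] pi_gt3 by simp
      have "pi * real k \<le> (pi * real (Suc k)) * 1" by simp
      also have "\<dots> \<le> (pi * real (Suc k)) * (pi * real (Suc k))"
        by (intro mult_left_mono 1) simp
      finally show ?thesis .
    qed
    then have s: "sqrt (pi * real k) \<le> pi * real (Suc k)"
      by (intro real_le_lsqrt) (auto simp: power2_eq_square)
    have k: "real (Suc k) \<le> 1 / c * exp (c * real (Suc k))"
    proof -
      have "c * real (Suc k) \<le> exp (c * real (Suc k))"
        using exp_ge_add_one_self[of "c * real (Suc k)"] by linarith
      then show ?thesis using c by (simp add: pos_le_divide_eq mult.commute)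
    qed
    have "sqrt (pi * real k) * (2 * real (Suc k)) ^ d * 2 ^ k
        \<le> (pi * real (Suc k)) * (2 * real (Suc k)) ^ d * 2 ^ k"
      by (intro mult_right_mono s) auto
    also have "\<dots> = pi * 2 ^ d * real (Suc k) ^ Suc d * 2 ^ k"
      by (simp only: power_mult_distrib power_Suc mult_ac)
    also have "\<dots> \<le> pi * 2 ^ d * (1 / c * exp (c * real (Suc k))) ^ Suc d * 2 ^ k"
      by (intro mult_right_mono mult_left_mono power_mono k) auto
    also have "(1 / c * exp (c * real (Suc k))) ^ Suc d = (1 / c) ^ Suc d * exp (\<delta> * real (Suc k))"
      unfolding power_mult_distrib exp_of_nat_mult[symmetric] by (simp add: c_def)
    also have "pi * 2 ^ d * ((1 / c) ^ Suc d * exp (\<delta> * real (Suc k))) * 2 ^ k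
        = D * (exp (- \<delta>) * exp (\<delta> * real (Suc k)) * exp (real k * ln 2))"
      by (simp add: D_def exp_minus exp_of_nat_mult)
    also have "exp (- \<delta>) * exp (\<delta> * real (Suc k)) * exp (real k * ln 2) = exp (real k)"
      unfolding exp_add[symmetric] by (simp add: \<delta>_def algebra_simps)
    finally show ?thesis .
  qed
  moreover have "D > 0" using c by (simp add: D_def)
  ultimately show thesis using that by blast
qed

text \<open>All the analysis, separated from the arithmetic in k and R. \<open>B\<close> is the mass
  of the correcting point masses, and \<open>2 * tv_norm u0 + B\<close> adds the variation bounds of
  the two measures.\<close>

lemma Pk_solution_bound:
  fixes u0 uk :: "('n::finite) sm"
  defines "d \<equiv> real CARD('n)"
  assumes u0: "is_fsm u0" "sm_supp_in u0 (cube R)" and R: "R > 0" and k: "k \<ge> 1" and T: "T > 0"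
    and uk: "Pk_solution R k T y uk"
  obtains B where
    "0 \<le> B"
    "B \<le> 2 ^ k * sqrt (real k) ^ k * max (T ^ (k div 2)) 1 * sup_norm_idx k (obs_err k T y u0)
       * (2 * real (Suc k) * exp (real k / R)) ^ CARD('n)"
    "kant_norm_diff (cube R) uk u0
      \<le> sqrt (2 * d) * pi * d * R / real k * (2 * tv_norm u0 + B) + d * R * B
        + sup_norm_idx k (obs_err k T y u0)"
proof -
  define eps where "eps = sup_norm_idx k (obs_err k T y u0)"
  define m where "m \<alpha> = expmA k T (obs_err k T y u0) \<alpha>" for \<alpha>
  define b where "b = 2 ^ k * sqrt (real k) ^ k * max (T ^ (k div 2)) 1 * eps"
  let ?C = "cube R :: (real^'n) set"
  let ?g = "\<lambda>\<alpha> x. indicator ?C x * mono_pow \<alpha> x"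
  let ?J = "grid (Suc k) :: ('n \<Rightarrow> nat) set"
  let ?x = "grid_point R (Suc k) :: _ \<Rightarrow> real^'n"
  have R0: "R \<ge> 0" using R by simp
  have eps: "\<bar>obs_err k T y u0 \<alpha>\<bar> \<le> eps" if "\<alpha> \<in> multi_idx k" for \<alpha>
    unfolding eps_def sup_norm_idx_def using that by (intro Max_ge) (auto simp: finite_multi_idx)
  have zero: "(\<lambda>_. 0) \<in> (multi_idx k :: ('n \<Rightarrow> nat) set)" by (simp add: multi_idx_def)
  have m: "\<bar>m \<alpha>\<bar> \<le> b" if "\<alpha> \<in> multi_idx k" for \<alpha>
    unfolding m_def b_def using T k by (intro expmA_bound eps that) auto
  obtain w where w: "\<And>\<beta>. \<beta> \<in> multi_idx k \<Longrightarrow> (\<Sum>j\<in>?J. w j * mono_pow \<beta> (?x j)) = m \<beta>"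
    and wb: "(\<Sum>j\<in>?J. \<bar>w j\<bar>) \<le> b * (2 * real (Suc k) * exp (real k / R)) ^ CARD('n)"
    using exists_grid_weights[OF R, of k m b] m by blast
  define B where "B = (\<Sum>j\<in>?J. \<bar>w j\<bar>)"
  have g: "bounded_borel (?g \<alpha>)" for \<alpha>
    by (intro bounded_borel_cube_continuous continuous_mono_pow)
  have xC: "?x j \<in> ?C" for j using R0 by (rule grid_point_in_cube)
  have mval: "m \<alpha> = expmA k T y \<alpha> - sm_int u0 (?g \<alpha>)" if "\<alpha> \<in> multi_idx k" for \<alpha>
    unfolding m_def using expmA_obs_err[OF u0 T R0 that] .
  have ukf: "is_fsm uk" "sm_supp_in uk ?C"
    and uk_int: "\<And>\<alpha>. \<alpha> \<in> multi_idx k \<Longrightarrow> sm_int uk (?g \<alpha>) = expmA k T y \<alpha>"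
    using uk by (auto simp: Pk_solution_def Pk_feasible_def)
  have "Pk_feasible R k T y (sm_add_points u0 ?J w ?x)"
    unfolding Pk_feasible_def
  proof (intro conjI ballI)
    show "is_fsm (sm_add_points u0 ?J w ?x)" by (rule is_fsm_add_points[OF u0(1) finite_grid])
    show "sm_supp_in (sm_add_points u0 ?J w ?x) ?C" by (rule sm_supp_in_add_points[OF u0(1) finite_grid u0(2) xC])
    fix \<alpha> :: "'n \<Rightarrow> nat" assume \<alpha>: "\<alpha> \<in> multi_idx k"
    have "sm_int (sm_add_points u0 ?J w ?x) (?g \<alpha>) = sm_int u0 (?g \<alpha>) + (\<Sum>j\<in>?J. w j * ?g \<alpha> (?x j))"
      by (rule sm_int_add_points[OF u0(1) finite_grid g])
    also have "(\<Sum>j\<in>?J. w j * ?g \<alpha> (?x j)) = m \<alpha>" using w[OF \<alpha>] xC by simp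
    finally show "sm_int (sm_add_points u0 ?J w ?x) (?g \<alpha>) = expmA k T y \<alpha>"
      using mval[OF \<alpha>] by simp
  qed
  then have "tv_norm uk \<le> tv_norm (sm_add_points u0 ?J w ?x)"
    using uk unfolding Pk_solution_def by blast
  also have "\<dots> \<le> tv_norm u0 + B"
    unfolding B_def by (rule tv_norm_add_points_le[OF u0(1) finite_grid])
  finally have tv: "tv_norm uk \<le> tv_norm u0 + B" .
  define K where "K = sqrt (2 * d) * pi * d * R / real k"
  have K0: "K \<ge> 0" using R by (simp add: K_def d_def)
  have "kant_norm_diff ?C uk u0 \<le> K * (2 * tv_norm u0 + B) + d * R * B + eps"
    unfolding kant_norm_diff_def
  proof (rule cSup_least)
    show "{sm_int uk (\<lambda>x. indicator ?C x * v x) - sm_int u0 (\<lambda>x. indicator ?C x * v x) | v.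
      continuous_on ?C v \<and> (\<forall>x\<in>?C. \<bar>v x\<bar> \<le> 1) \<and> 1-lipschitz_on ?C v} \<noteq> {}"
      by (auto intro!: exI[of _ "\<lambda>_. 0"] simp: lipschitz_on_def)
    fix r assume "r \<in> {sm_int uk (\<lambda>x. indicator ?C x * v x) - sm_int u0 (\<lambda>x. indicator ?C x * v x) | v.
      continuous_on ?C v \<and> (\<forall>x\<in>?C. \<bar>v x\<bar> \<le> 1) \<and> 1-lipschitz_on ?C v}"
    then obtain v where r: "r = sm_int uk (\<lambda>x. indicator ?C x * v x) - sm_int u0 (\<lambda>x. indicator ?C x * v x)"
      and v: "continuous_on ?C v" "\<And>x. x \<in> ?C \<Longrightarrow> \<bar>v x\<bar> \<le> 1" "1-lipschitz_on ?C v" by blast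
    have z: "0 \<in> ?C" using R by (simp add: cube_def)
    have vl: "1-lipschitz_on ?C (\<lambda>x. v x - v 0)"
      using v(3) by (simp add: lipschitz_on_def dist_norm)
    have vb: "\<bar>v x - v 0\<bar> \<le> d * R" if x: "x \<in> ?C" for x
    proof -
      have "\<bar>v x - v 0\<bar> \<le> dist x 0" using lipschitz_onD[OF v(3) x z] by (simp add: dist_real_def)
      also have "\<dots> \<le> (\<Sum>i\<in>UNIV. \<bar>x $ i\<bar>)" using norm_le_l1_cart[of x] by (simp add: dist_norm)
      also have "\<dots> \<le> (\<Sum>i\<in>(UNIV::'n set). R)" using x by (intro sum_mono) (simp add: cube_def)
      finally show ?thesis by (simp add: d_def)
    qed
    obtain c where c1: "\<And>x. x \<in> ?C \<Longrightarrow> \<bar>v x - v 0 - (\<Sum>\<alpha>\<in>multi_idx k. c \<alpha> * mono_pow \<alpha> x)\<bar> \<le> K"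
      and c2: "\<And>x. x \<in> ?C \<Longrightarrow> \<bar>\<Sum>\<alpha>\<in>multi_idx k. c \<alpha> * mono_pow \<alpha> x\<bar> \<le> d * R"
      using jackson_cube[OF R k vl vb] unfolding K_def d_def by blast
    \<comment> \<open>The constant v(0) is merged into the coefficient of the zero index, so that
      v(0) + p is tested as one polynomial.\<close>
    define c' where "c' \<alpha> = c \<alpha> + (if \<alpha> = (\<lambda>_. 0) then v 0 else 0)" for \<alpha>
    have c': "(\<Sum>\<alpha>\<in>multi_idx k. c' \<alpha> * h \<alpha>) = (\<Sum>\<alpha>\<in>multi_idx k. c \<alpha> * h \<alpha>) + v 0 * h (\<lambda>_. 0)"
      for h :: "('n \<Rightarrow> nat) \<Rightarrow> real"
    proof -
      have "(\<Sum>\<alpha>\<in>multi_idx k. c' \<alpha> * h \<alpha>)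
          = (\<Sum>\<alpha>\<in>multi_idx k. c \<alpha> * h \<alpha> + (if \<alpha> = (\<lambda>_. 0) then v 0 * h (\<lambda>_. 0) else 0))"
        by (intro sum.cong refl) (auto simp: c'_def distrib_right)
      then show ?thesis using zero by (simp add: sum.distrib finite_multi_idx)
    qed
    let ?f = "\<lambda>x. indicator ?C x * v x"
    define q where "q x = (\<Sum>\<alpha>\<in>multi_idx k. c' \<alpha> * ?g \<alpha> x)" for x
    have qC: "q x = indicator ?C x * ((\<Sum>\<alpha>\<in>multi_idx k. c \<alpha> * mono_pow \<alpha> x) + v 0)" for x
      unfolding q_def c' by (simp add: sum_distrib_left distrib_left mult_ac mono_pow_def)
    have f: "bounded_borel ?f" by (rule bounded_borel_cube_continuous[OF v(1)])
    have q: "bounded_borel q"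
      unfolding qC[abs_def] by (intro bounded_borel_cube_continuous continuous_intros continuous_mono_pow)
    have err: "\<bar>sm_int \<mu> ?f - sm_int \<mu> q\<bar> \<le> K * tv_norm \<mu>" if "is_fsm \<mu>" "sm_supp_in \<mu> ?C" for \<mu>
      unfolding sm_int_diff[OF that(1) f q, symmetric]
    proof (rule abs_sm_int_le[OF that bounded_borel_diff[OF f q] _ K0])
      fix x assume "x \<in> ?C"
      then show "\<bar>?f x - q x\<bar> \<le> K" using c1[of x] by (simp add: qC algebra_simps)
    qed
    have "sm_int uk q - sm_int u0 q = (\<Sum>\<alpha>\<in>multi_idx k. c' \<alpha> * m \<alpha>)"
      unfolding q_def sm_int_sum_scale[OF ukf(1) g] sm_int_sum_scale[OF u0(1) g] sum_subtractf[symmetric]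
      by (intro sum.cong refl) (simp add: uk_int mval right_diff_distrib)
    also have "\<dots> = (\<Sum>\<alpha>\<in>multi_idx k. c \<alpha> * (\<Sum>j\<in>?J. w j * mono_pow \<alpha> (?x j))) + v 0 * m (\<lambda>_. 0)"
      unfolding c' by (simp add: w)
    \<comment> \<open>Writing the moments as grid sums replaces the coefficients of p by its values
      at the nodes; these are bounded by d R, whereas the coefficients may be huge.\<close>
    also have "\<dots> = (\<Sum>j\<in>?J. w j * (\<Sum>\<alpha>\<in>multi_idx k. c \<alpha> * mono_pow \<alpha> (?x j))) + v 0 * m (\<lambda>_. 0)"
      unfolding sum_distrib_left by (subst sum.swap) (simp add: mult_ac)
    finally have "\<bar>sm_int uk q - sm_int u0 q\<bar>
        \<le> \<bar>\<Sum>j\<in>?J. w j * (\<Sum>\<alpha>\<in>multi_idx k. c \<alpha> * mono_pow \<alpha> (?x j))\<bar> + \<bar>v 0 * m (\<lambda>_. 0)\<bar>"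
      by (simp only: abs_triangle_ineq)
    also have "\<dots> \<le> (\<Sum>j\<in>?J. \<bar>w j\<bar> * (d * R)) + 1 * eps"
    proof (rule add_mono)
      show "\<bar>\<Sum>j\<in>?J. w j * (\<Sum>\<alpha>\<in>multi_idx k. c \<alpha> * mono_pow \<alpha> (?x j))\<bar> \<le> (\<Sum>j\<in>?J. \<bar>w j\<bar> * (d * R))"
        using c2[OF xC] by (intro order_trans[OF sum_abs] sum_mono) (simp add: abs_mult mult_left_mono)
      show "\<bar>v 0 * m (\<lambda>_. 0)\<bar> \<le> 1 * eps"
        unfolding abs_mult m_def expmA_zero_index by (intro mult_mono v(2)[OF z] eps zero) auto
    qed
    finally have mid: "\<bar>sm_int uk q - sm_int u0 q\<bar> \<le> d * R * B + eps"
      unfolding sum_distrib_right[symmetric] B_def by (simp add: mult.commute)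
    have "r \<le> K * tv_norm uk + K * tv_norm u0 + (d * R * B + eps)"
      unfolding r using err[OF ukf] err[OF u0] mid by linarith
    also have "K * tv_norm uk \<le> K * (tv_norm u0 + B)" by (rule mult_left_mono[OF tv K0])
    finally show "r \<le> K * (2 * tv_norm u0 + B) + d * R * B + eps" by (simp add: algebra_simps)
  qed
  moreover have "B \<ge> 0" by (simp add: B_def sum_nonneg)
  ultimately show thesis
    using wb by (intro that[of B]) (simp_all only: K_def B_def b_def eps_def)
qed

theorem mainTheorem2:
  "\<exists>C>0. \<forall>(u0 :: ('n::finite) sm) (R::real) (k::nat) (T::real) y uk.
     is_fsm u0 \<and> R > 0 \<and> sm_supp_in u0 (cube R) \<and> k \<ge> 1 \<and> T > 0 \<and> Pk_solution R k T y uk \<longrightarrow>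
     kant_norm_diff (cube R) uk u0
       \<le> C * R * tv_norm u0 / real k
         + (sqrt (real k / pi) + C * R / sqrt (pi * real k))
           * exp (real k * (1 + 2 * real CARD('n) / R + ln (sqrt (real k))))
           * max (T ^ (k div 2)) 1 * sup_norm_idx k (obs_err k T y u0)"
proof -
  define d where "d = real CARD('n)"
  have d1: "d > 0" by (simp add: d_def)
  obtain D where D: "D > 0" "\<And>k::nat. sqrt (pi * real k) * (2 * real (Suc k)) ^ CARD('n) * 2 ^ k \<le> D * exp (real k)"
    using power_times_two_power_le_exp by blast
  define K where "K = sqrt (2 * d) * pi * d"
  have K0: "K > 0" using d1 by (simp add: K_def)
  \<comment> \<open>2 K is the Jackson error against twice the variation of u0; (K + d) D collects
    the two terms that contain the mass B.\<close>
  define C where "C = 2 * K + (K + d) * D"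
  have C0: "C > 0" unfolding C_def using K0 d1 D(1) by (intro add_pos_pos mult_pos_pos) auto
  have "kant_norm_diff (cube R) uk u0
       \<le> C * R * tv_norm u0 / real k
         + (sqrt (real k / pi) + C * R / sqrt (pi * real k))
           * exp (real k * (1 + 2 * d / R + ln (sqrt (real k))))
           * max (T ^ (k div 2)) 1 * sup_norm_idx k (obs_err k T y u0)"
    if as: "is_fsm u0" "R > 0" "sm_supp_in u0 (cube R)" "k \<ge> 1" "T > 0" "Pk_solution R k T y uk"
    for u0 uk :: "'n sm" and R k T y
  proof -
    define E where "E = exp (real k * (1 + 2 * d / R + ln (sqrt (real k))))"
    define M where "M = max (T ^ (k div 2)) 1"
    define eps where "eps = sup_norm_idx k (obs_err k T y u0)"
    define s where "s = sqrt (pi * real k)"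
    note R = as(2) and k = as(4)
    have s0: "s > 0" using k by (simp add: s_def)
    have M1: "M \<ge> 1" by (simp add: M_def)
    have eps0: "eps \<ge> 0"
    proof -
      have "(\<lambda>_. 0) \<in> (multi_idx k :: ('n \<Rightarrow> nat) set)" by (simp add: multi_idx_def)
      then have "\<bar>obs_err k T y u0 (\<lambda>_. 0)\<bar> \<le> eps"
        unfolding eps_def sup_norm_idx_def by (intro Max_ge) (auto simp: finite_multi_idx)
      then show ?thesis by linarith
    qed
    have E: "E = exp (real k) * sqrt (real k) ^ k * exp (2 * d * real k / R)"
    proof -
      have "sqrt (real k) ^ k = exp (real k * ln (sqrt (real k)))"
        using k by (simp add: exp_of_nat_mult)
      then show ?thesis unfolding E_def by (simp add: distrib_left mult_ac flip: exp_add)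
    qed
    obtain B where B: "0 \<le> B"
      "B \<le> 2 ^ k * sqrt (real k) ^ k * M * eps * (2 * real (Suc k) * exp (real k / R)) ^ CARD('n)"
      and kant: "kant_norm_diff (cube R) uk u0 \<le> K * R / real k * (2 * tv_norm u0 + B) + d * R * B + eps"
      using Pk_solution_bound[OF as(1,3,2,4,5,6)] unfolding K_def d_def M_def eps_def by blast
    have "s * B \<le> s * (2 ^ k * sqrt (real k) ^ k * M * eps * (2 * real (Suc k) * exp (real k / R)) ^ CARD('n))"
      using s0 by (intro mult_left_mono B) simp
    also have "\<dots> = (s * (2 * real (Suc k)) ^ CARD('n) * 2 ^ k) * (sqrt (real k) ^ k * exp (d * real k / R) * M * eps)"
      unfolding power_mult_distrib exp_of_nat_mult[symmetric] d_def by (simp add: mult_ac)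
    \<comment> \<open>exp (d k/R) is relaxed to the exp (2 d k/R) of the claim, and multiplying by s
      beforehand makes the division by sqrt (pi k) available.\<close>
    also have "\<dots> \<le> (D * exp (real k)) * (sqrt (real k) ^ k * exp (2 * d * real k / R) * M * eps)"
      unfolding s_def using R d1 M1 eps0 D(1)
      by (intro mult_mono D(2)) (auto intro!: divide_right_mono mult_right_mono)
    also have "\<dots> = D * (E * M * eps)" by (simp add: E mult_ac)
    finally have sB: "B \<le> D * (E * M * eps) / s" using s0 by (simp add: le_divide_eq mult.commute)
    \<comment> \<open>The bare error term must fit under the summand without a free constant: sqrt
      (k/pi) \<ge> 1/2 because pi < 4, and E \<ge> exp k \<ge> 2.\<close>
    have "1 \<le> sqrt (real k / pi) * E"
    proof -
      have "(1 / 2)\<^sup>2 \<le> real k / pi" using k pi_less_4 by (simp add: le_divide_eq power2_eq_square)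
      then have a: "1 / 2 \<le> sqrt (real k / pi)" by (rule real_le_rsqrt)
      have "2 \<le> exp (real k)" using exp_ge_add_one_self[of "real k"] k by linarith
      moreover have "exp (real k) * 1 \<le> exp (real k) * (sqrt (real k) ^ k * exp (2 * d * real k / R))"
        using k R d1 by (intro mult_left_mono) (auto intro!: mult_ge1_I one_le_power)
      ultimately have "2 \<le> E" unfolding E mult.assoc by linarith
      with a have "1 / 2 * 2 \<le> sqrt (real k / pi) * E" by (intro mult_mono) auto
      then show ?thesis by simp
    qed
    then have "1 * 1 \<le> (sqrt (real k / pi) * E) * M" using M1 by (intro mult_mono) auto
    from mult_right_mono[OF this eps0] have e: "eps \<le> sqrt (real k / pi) * (E * M * eps)"
      by (simp add: mult_ac)
    have X0: "E * M * eps \<ge> 0" using M1 eps0 by (simp add: E_def)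
    have "K * R / real k * B + d * R * B \<le> (K + d) * R * B"
    proof -
      have "K * R / real k \<le> K * R" using k K0 R by (simp add: divide_le_eq mult_left_le)
      from mult_right_mono[OF this B(1)] show ?thesis by (simp add: algebra_simps)
    qed
    also have "\<dots> \<le> (K + d) * R * (D * (E * M * eps) / s)"
      using K0 d1 R by (intro mult_left_mono sB) auto
    also have "\<dots> = ((K + d) * D) * (R * (E * M * eps) / s)" by simp
    also have "\<dots> \<le> C * (R * (E * M * eps) / s)"
      using X0 R s0 K0 by (intro mult_right_mono) (auto simp: C_def)
    finally have 2: "K * R / real k * B + d * R * B \<le> C * R / s * (E * M * eps)" by simp
    have 3: "2 * K * (R * tv_norm u0 / real k) \<le> C * (R * tv_norm u0 / real k)"
      using tv_norm_nonneg[OF as(1)] R K0 d1 D(1) by (intro mult_right_mono) (auto simp: C_def)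
    have "kant_norm_diff (cube R) uk u0
        \<le> 2 * K * (R * tv_norm u0 / real k) + (K * R / real k * B + d * R * B) + eps"
      using kant by (simp add: algebra_simps)
    also have "\<dots> \<le> C * (R * tv_norm u0 / real k) + C * R / s * (E * M * eps) + sqrt (real k / pi) * (E * M * eps)"
      using 2 3 e by linarith
    also have "\<dots> = C * R * tv_norm u0 / real k + (sqrt (real k / pi) + C * R / s) * E * M * eps"
      by (simp add: algebra_simps)
    finally show ?thesis unfolding E_def M_def eps_def s_def .
  qed
  then show ?thesis using C0 unfolding d_def by (intro exI[of _ C]) blast
qed

end
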